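(* Let $R$ be a weakly $2$-primal ring and let $G$ be a nilpotent group. Then the following statements are equivalent: (1) the group ring $RG$ is semi-nil clean; (2) $R$ is periodic and $G$ is locally finite; (3) $RG$ is periodic.
   Context: Rings are associative with identity, not necessarily commutative. An element $x$ of a ring is periodic if there exist two different positive integers $m\neq n$ with $x^m=x^n$; a ring is periodic if all its elements are periodic. A ring is semi-nil clean if each of its elements is the sum of a periodic element and a nilpotent element (no commutation required). A ring $R$ is weakly $2$-primal if the set ${\rm Nil}(R)$ of all nilpotent elements of $R$ equals the Levitzki radical of $R$ (the largest locally nilpotent two-sided ideal). A group is locally finite if each of its finitely generated subgroups is finite. *)

theory Defs
  imports Complex_Main "HOL-Library.Poly_Mapping"
begin

section \<open>Rings\<close>

text \<open>A ring is a type of class \<^class>\<open>ring_1\<close>: associative, with identity, not necessarily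
  commutative, and with \<open>0 \<noteq> 1\<close>.\<close>

definition periodic_element :: "'a::monoid_mult \<Rightarrow> bool" where
  "periodic_element x \<longleftrightarrow> (\<exists>m n. 0 < m \<and> 0 < n \<and> m \<noteq> n \<and> x ^ m = x ^ n)"

definition nilpotent_element :: "'a::ring_1 \<Rightarrow> bool" where
  "nilpotent_element x \<longleftrightarrow> (\<exists>n>0. x ^ n = 0)"

definition periodic_ring :: "'a::ring_1 itself \<Rightarrow> bool" where
  "periodic_ring _ \<longleftrightarrow> (\<forall>x::'a. periodic_element x)"

definition semi_nil_clean_ring :: "'a::ring_1 itself \<Rightarrow> bool" where
  "semi_nil_clean_ring _ \<longleftrightarrow>
    (\<forall>x::'a. \<exists>p q. periodic_element p \<and> nilpotent_element q \<and> x = p + q)"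

definition two_sided_ideal :: "'a::ring_1 set \<Rightarrow> bool" where
  "two_sided_ideal I \<longleftrightarrow> 0 \<in> I \<and> (\<forall>x\<in>I. \<forall>y\<in>I. x + y \<in> I) \<and>
    (\<forall>x\<in>I. - x \<in> I) \<and> (\<forall>r. \<forall>x\<in>I. r * x \<in> I \<and> x * r \<in> I)"

text \<open>For every finite subset there is an \<open>N\<close> such that all products of \<open>N\<close> of its elements,
  repetitions allowed and in any order, vanish.\<close>

definition locally_nilpotent :: "'a::ring_1 set \<Rightarrow> bool" where
  "locally_nilpotent S \<longleftrightarrow> (\<forall>F. finite F \<and> F \<subseteq> S \<longrightarrow>
    (\<exists>N. \<forall>xs. set xs \<subseteq> F \<and> length xs = N \<longrightarrow> prod_list xs = 0))"

text \<open>Greatest with respect to inclusion; it exists by \<open>levitzki_radical_greatest\<close> below.\<close>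

definition levitzki_radical :: "'a::ring_1 set" where
  "levitzki_radical = (GREATEST I. two_sided_ideal I \<and> locally_nilpotent I)"

definition weakly_2_primal :: "'a::ring_1 itself \<Rightarrow> bool" where
  "weakly_2_primal _ \<longleftrightarrow> {x::'a. nilpotent_element x} = levitzki_radical"

subsection \<open>Existence of the Levitzki radical\<close>

lemma two_sided_ideal_prod_list_diff:
  fixes I :: "'a::ring_1 set"
  assumes I: "two_sided_ideal I" and d: "\<And>x. x \<in> set xs \<Longrightarrow> x - b x \<in> I"
  shows "prod_list xs - prod_list (map b xs) \<in> I"
  using d
proof (induction xs)
  case Nil
  then show ?case using I by (simp add: two_sided_ideal_def)
next
  case (Cons x xs)
  have "prod_list (x # xs) - prod_list (map b (x # xs)) =
      (x - b x) * prod_list xs + b x * (prod_list xs - prod_list (map b xs))"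
    by (simp add: algebra_simps)
  moreover have "x - b x \<in> I" "prod_list xs - prod_list (map b xs) \<in> I"
    using Cons by auto
  ultimately show ?case using I by (simp add: two_sided_ideal_def)
qed

lemma locally_nilpotent_blocks:
  fixes F :: "'a::ring_1 set"
  assumes "\<And>ys. set ys \<subseteq> {prod_list zs | zs. set zs \<subseteq> F \<and> length zs = N} \<Longrightarrow> length ys = M
      \<Longrightarrow> prod_list ys = 0"
    and "set xs \<subseteq> F" and "length xs = N * M"
  shows "prod_list xs = 0"
proof -
  have "\<exists>ys. set ys \<subseteq> {prod_list zs | zs. set zs \<subseteq> F \<and> length zs = N} \<and> length ys = M
      \<and> prod_list ys = prod_list xs"
    using assms(2,3)
  proof (induction M arbitrary: xs)
    case 0
    then show ?case by simp
  next
    case (Suc M)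
    have "set (drop N xs) \<subseteq> F" "length (drop N xs) = N * M"
      using Suc.prems set_drop_subset[of N xs] by auto
    from Suc.IH[OF this] obtain ys where
      ys: "set ys \<subseteq> {prod_list zs | zs. set zs \<subseteq> F \<and> length zs = N}" "length ys = M"
        "prod_list ys = prod_list (drop N xs)" by blast
    have "set (take N xs) \<subseteq> F" "length (take N xs) = N"
      using Suc.prems set_take_subset[of N xs] by auto
    then have "prod_list (take N xs) \<in> {prod_list zs | zs. set zs \<subseteq> F \<and> length zs = N}"
      by blast
    moreover have "prod_list (take N xs) * prod_list (drop N xs) = prod_list xs"
      by (metis append_take_drop_id prod_list.append)
    ultimately show ?case using ys by (intro exI[of _ "prod_list (take N xs) # ys"]) auto
  qed
  then obtain ys where "set ys \<subseteq> {prod_list zs | zs. set zs \<subseteq> F \<and> length zs = N}" "length ys = M"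
    "prod_list ys = prod_list xs" by blast
  with assms(1)[of ys] show ?thesis by argo
qed

lemma locally_nilpotent_sum:
  fixes I J :: "'a::ring_1 set"
  assumes I: "two_sided_ideal I" "locally_nilpotent I" and J: "locally_nilpotent J"
  shows "locally_nilpotent {x + y | x y. x \<in> I \<and> y \<in> J}"
  unfolding locally_nilpotent_def
proof (intro allI impI, elim conjE)
  fix F :: "'a set"
  assume F: "finite F" "F \<subseteq> {x + y | x y. x \<in> I \<and> y \<in> J}"
  have "\<forall>f\<in>F. \<exists>y. y \<in> J \<and> f - y \<in> I"
  proof
    fix f assume "f \<in> F"
    then obtain x y where "f = x + y" "x \<in> I" "y \<in> J" using F(2) by blast
    then show "\<exists>y. y \<in> J \<and> f - y \<in> I" by auto
  qed
  then obtain b where b: "\<And>f. f \<in> F \<Longrightarrow> b f \<in> J" "\<And>f. f \<in> F \<Longrightarrow> f - b f \<in> I"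
    by metis
  have "finite (b ` F)" "b ` F \<subseteq> J" using F(1) b(1) by auto
  then obtain N where
    N: "\<And>xs. set xs \<subseteq> b ` F \<Longrightarrow> length xs = N \<Longrightarrow> prod_list xs = 0"
    using J unfolding locally_nilpotent_def by meson
  define P where "P = {prod_list zs | zs. set zs \<subseteq> F \<and> length zs = N}"
  have "P = prod_list ` {zs. set zs \<subseteq> F \<and> length zs = N}" by (auto simp: P_def)
  then have "finite P" using finite_lists_length_eq[OF F(1), of N] by simp
  moreover have "P \<subseteq> I"
  proof
    fix p assume "p \<in> P"
    then obtain zs where zs: "p = prod_list zs" "set zs \<subseteq> F" "length zs = N"
      by (auto simp: P_def)
    have "prod_list (map b zs) = 0" using N[of "map b zs"] zs by auto
    moreover have "prod_list zs - prod_list (map b zs) \<in> I"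
      using two_sided_ideal_prod_list_diff[OF I(1), of zs b] b(2) zs(2) by blast
    ultimately show "p \<in> I" using zs(1) by simp
  qed
  ultimately obtain M where
    M: "\<And>xs. set xs \<subseteq> P \<Longrightarrow> length xs = M \<Longrightarrow> prod_list xs = 0"
    using I(2) unfolding locally_nilpotent_def by meson
  show "\<exists>N. \<forall>xs. set xs \<subseteq> F \<and> length xs = N \<longrightarrow> prod_list xs = 0"
  proof (intro exI allI impI, elim conjE)
    fix xs assume "set xs \<subseteq> F" and "length xs = N * M"
    show "prod_list xs = 0"
      by (rule locally_nilpotent_blocks[of F N M xs, folded P_def]) (fact M, fact+)
  qed
qed

lemma two_sided_ideal_sum:
  fixes I J :: "'a::ring_1 set"
  assumes I: "two_sided_ideal I" and J: "two_sided_ideal J"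
  shows "two_sided_ideal {x + y | x y. x \<in> I \<and> y \<in> J}"
proof -
  define S where "S = {x + y | x y. x \<in> I \<and> y \<in> J}"
  have mem: "s \<in> S" if "s = x + y" "x \<in> I" "y \<in> J" for s x y
    using that unfolding S_def by blast
  have dest: "\<exists>x\<in>I. \<exists>y\<in>J. s = x + y" if "s \<in> S" for s
    using that unfolding S_def by blast
  have zero: "0 \<in> S"
    by (rule mem[of 0 0 0]) (use I J in \<open>simp_all add: two_sided_ideal_def\<close>)
  have add: "u + v \<in> S" if uv: "u \<in> S" "v \<in> S" for u v
  proof -
    obtain a b c d where *: "u = a + b" "v = c + d" "a \<in> I" "c \<in> I" "b \<in> J" "d \<in> J"
      using dest[OF uv(1)] dest[OF uv(2)] by blast
    show ?thesis
    proof (rule mem)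
      show "u + v = (a + c) + (b + d)" using *(1,2) by (simp add: algebra_simps)
      show "a + c \<in> I" "b + d \<in> J" using I J *(3-6) unfolding two_sided_ideal_def by simp_all
    qed
  qed
  have other: "- u \<in> S" "r * u \<in> S" "u * r \<in> S" if u: "u \<in> S" for u r
  proof -
    obtain a b where *: "u = a + b" "a \<in> I" "b \<in> J" using dest[OF u] by blast
    have 1: "- a \<in> I" "- b \<in> J" "r * a \<in> I" "r * b \<in> J" "a * r \<in> I" "b * r \<in> J"
      using I J *(2,3) unfolding two_sided_ideal_def by simp_all
    have 2: "- u = - a + - b" "r * u = r * a + r * b" "u * r = a * r + b * r"
      using *(1) by (simp_all add: distrib_left distrib_right)
    show "- u \<in> S" using mem[OF 2(1) 1(1,2)] .
    show "r * u \<in> S" using mem[OF 2(2) 1(3,4)] .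
    show "u * r \<in> S" using mem[OF 2(3) 1(5,6)] .
  qed
  have "two_sided_ideal S" unfolding two_sided_ideal_def
    by (intro conjI ballI allI zero add other)
  then show ?thesis unfolding S_def .
qed

lemma levitzki_radical_greatest:
  "two_sided_ideal (levitzki_radical :: 'a::ring_1 set)"
  "locally_nilpotent (levitzki_radical :: 'a set)"
  "two_sided_ideal I \<Longrightarrow> locally_nilpotent I \<Longrightarrow> I \<subseteq> (levitzki_radical :: 'a set)"
proof -
  define P where "P I \<longleftrightarrow> two_sided_ideal I \<and> locally_nilpotent I" for I :: "'a set"
  define L where "L = \<Union>{I. P I}"
  have zero: "P {0}"
  proof -
    have "prod_list xs = 0" if "set xs \<subseteq> F" "F \<subseteq> {0}" "length xs = 1" for xs :: "'a list" and F
      using that by (cases xs) auto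
    then have "locally_nilpotent {0::'a}" unfolding locally_nilpotent_def by blast
    then show ?thesis by (simp add: P_def two_sided_ideal_def)
  qed
  have sup: "\<exists>K. P K \<and> I \<subseteq> K \<and> J \<subseteq> K" if "P I" "P J" for I J
  proof (intro exI conjI)
    show "P {x + y | x y. x \<in> I \<and> y \<in> J}"
      using that two_sided_ideal_sum locally_nilpotent_sum unfolding P_def by blast
    have "0 \<in> I" "0 \<in> J" using that by (auto simp: P_def two_sided_ideal_def)
    then show "I \<subseteq> {x + y | x y. x \<in> I \<and> y \<in> J}" "J \<subseteq> {x + y | x y. x \<in> I \<and> y \<in> J}"
      by force+
  qed
  have fin: "\<exists>I. P I \<and> F \<subseteq> I" if "finite F" "F \<subseteq> L" for F
    using that
  proof (induction F)
    case empty
    then show ?case using zero by blast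
  next
    case (insert x F)
    then obtain I J where IJ: "P I" "F \<subseteq> I" "P J" "x \<in> J" by (auto simp: L_def)
    from sup[OF IJ(1,3)] show ?case using IJ(2,4) by blast
  qed
  have "two_sided_ideal L"
  proof -
    have "0 \<in> L" using zero by (auto simp: L_def)
    moreover have "x + y \<in> L" if xy: "x \<in> L" "y \<in> L" for x y
    proof -
      obtain I where "P I" "x \<in> I" "y \<in> I" using fin[of "{x, y}"] xy by blast
      then have "x + y \<in> I" by (simp add: P_def two_sided_ideal_def)
      then show ?thesis using \<open>P I\<close> by (auto simp: L_def)
    qed
    moreover have "- x \<in> L \<and> r * x \<in> L \<and> x * r \<in> L" if x: "x \<in> L" for x r
    proof -
      obtain I where "P I" "x \<in> I" using x by (auto simp: L_def)
      then have "- x \<in> I \<and> r * x \<in> I \<and> x * r \<in> I" by (simp add: P_def two_sided_ideal_def)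
      then show ?thesis using \<open>P I\<close> by (auto simp: L_def)
    qed
    ultimately show ?thesis unfolding two_sided_ideal_def by blast
  qed
  moreover have "locally_nilpotent L"
    unfolding locally_nilpotent_def
  proof (intro allI impI, elim conjE)
    fix F :: "'a set" assume "finite F" "F \<subseteq> L"
    with fin obtain I where "P I" "F \<subseteq> I" by blast
    then show "\<exists>N. \<forall>xs. set xs \<subseteq> F \<and> length xs = N \<longrightarrow> prod_list xs = 0"
      using \<open>finite F\<close> unfolding P_def locally_nilpotent_def by blast
  qed
  ultimately have PL: "P L" by (simp add: P_def)
  have "levitzki_radical = L"
    unfolding levitzki_radical_def
    by (rule Greatest_equality) (use PL in \<open>auto simp: P_def L_def\<close>)
  then show "two_sided_ideal (levitzki_radical :: 'a set)"
    "locally_nilpotent (levitzki_radical :: 'a set)"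
    "two_sided_ideal I \<Longrightarrow> locally_nilpotent I \<Longrightarrow> I \<subseteq> (levitzki_radical :: 'a set)"
    using PL by (auto simp: P_def L_def)
qed

section \<open>Groups\<close>

text \<open>A group is a type of class \<^class>\<open>group_add\<close>, which does not assume commutativity; it is
  written additively only because this is the notation in which the library provides the
  convolution product on finitely supported functions.\<close>

definition subgroup_of :: "'g::group_add set \<Rightarrow> bool" where
  "subgroup_of H \<longleftrightarrow> 0 \<in> H \<and> (\<forall>x\<in>H. \<forall>y\<in>H. x + y \<in> H) \<and> (\<forall>x\<in>H. - x \<in> H)"

definition generated_subgroup :: "'g::group_add set \<Rightarrow> 'g set" where
  "generated_subgroup S = subgroup_of hull S"

definition locally_finite_group :: "'g::group_add itself \<Rightarrow> bool" where
  "locally_finite_group _ \<longleftrightarrow> (\<forall>S::'g set. finite S \<longrightarrow> finite (generated_subgroup S))"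

text \<open>Multiplicatively, \<open>x * y * inverse x * inverse y\<close>.\<close>

definition group_commutator :: "'g::group_add \<Rightarrow> 'g \<Rightarrow> 'g" where
  "group_commutator x y = x + y + (- x) + (- y)"

primrec lower_central_series :: "nat \<Rightarrow> 'g::group_add set" where
  "lower_central_series 0 = UNIV"
| "lower_central_series (Suc n) =
    generated_subgroup {group_commutator x y | x y. x \<in> lower_central_series n}"

definition nilpotent_group :: "'g::group_add itself \<Rightarrow> bool" where
  "nilpotent_group _ \<longleftrightarrow> (\<exists>n. lower_central_series n = {0::'g})"

section \<open>Group rings\<close>

text \<open>Finitely supported functions \<open>'g \<Rightarrow> 'r\<close>; the library's multiplication is convolution,
  the coefficient of \<open>f * h\<close> at \<open>k\<close> being the sum of \<open>f a * h b\<close> over all \<open>a\<close>, \<open>b\<close> with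
  \<open>k = a + b\<close>.\<close>

type_synonym ('r, 'g) group_ring = "'g \<Rightarrow>\<^sub>0 'r"

end

theory Submission
  imports Defs "HOL-Library.FuncSet" "HOL-Computational_Algebra.Primes"
begin

text \<open>
  The key fact is a theorem of Jacobson: a periodic ring \<open>R\<close> whose nilpotent elements form an ideal \<open>L\<close> is
  commutative modulo \<open>L\<close>. Otherwise some quotient of \<open>R\<close> is a non-commutative division ring in which all
  units have finite order; there one finds \<open>b a = a\<^sup>k b \<noteq> a b\<close>, and the norm map of the finite field generated by
  \<open>a\<close> and the powers of \<open>b\<close> that commute with \<open>a\<close> gives a contradiction by counting.

  Given this, if \<open>R\<close> is periodic and \<open>G\<close> is locally finite, then modulo \<open>L\<close> the coefficients of all powers of
  an element \<open>f\<close> of \<open>RG\<close> lie in one finite set, so \<open>f\<^sup>i - f\<^sup>j\<close> has coefficients in \<open>L\<close> for some \<open>i < j\<close> and is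
  nilpotent. As \<open>RG\<close> has positive characteristic, the binomial theorem yields \<open>f\<^sup>i\<^sup>t = f\<^sup>j\<^sup>t\<close> for some \<open>t > 0\<close>.

  Conversely, if \<open>RG\<close> is semi-nil clean then so is its quotient \<open>R\<close>, and \<open>R\<close> is periodic. The ring
  \<open>(R/L)[G/G']\<close> is commutative, so a decomposition \<open>g = p + q\<close> in \<open>RG\<close> and the same binomial argument show that
  every \<open>g\<close> in \<open>G\<close> is torsion modulo the commutator subgroup \<open>G'\<close>. In a nilpotent group this
  propagates down the lower central series and implies local finiteness.
\<close>

section \<open>Congruences modulo a two-sided ideal\<close>

text \<open>Cancelling \<open>i\<close> in \<open>times_binomial_minus1_eq\<close> consumes a factor
  of \<open>fact k\<close> and leaves \<open>N\<close> intact. In characteristic \<open>N\<close>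
  this kills the terms of degrees \<open>1\<close> to \<open>k\<close> of a binomial
  expansion.\<close>

lemma dvd_binomial_fact:
  assumes "0 < i" "i \<le> k" "0 < N"
  shows "N dvd (N * fact k) choose i"
proof -
  obtain q where q: "fact k = i * q" using dvd_fact[of i k] assms by auto
  have "i * ((N * fact k) choose i) = (N * fact k) * ((N * fact k - 1) choose (i - 1))"
    using assms(1) by (rule times_binomial_minus1_eq)
  then have "(N * fact k) choose i = N * (q * ((N * fact k - 1) choose (i - 1)))"
    using assms(1) by (simp add: q)
  then show ?thesis by simp
qed

locale ideal_congruence =
  fixes J :: "'a::ring_1 set"
  assumes ideal: "two_sided_ideal J"
begin

definition cong :: "'a \<Rightarrow> 'a \<Rightarrow> bool" (infix "\<approx>" 50) where
  "x \<approx> y \<longleftrightarrow> x - y \<in> J"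

lemma zero_mem: "0 \<in> J" and add_mem: "x \<in> J \<Longrightarrow> y \<in> J \<Longrightarrow> x + y \<in> J"
  and minus_mem: "x \<in> J \<Longrightarrow> - x \<in> J"
  and left_mem: "x \<in> J \<Longrightarrow> s * x \<in> J" and right_mem: "x \<in> J \<Longrightarrow> x * s \<in> J"
  using ideal unfolding two_sided_ideal_def by blast+

lemma diff_mem: "x \<in> J \<Longrightarrow> y \<in> J \<Longrightarrow> x - y \<in> J"
  using add_mem[OF _ minus_mem] by simp

lemma cong_0_iff: "x \<approx> 0 \<longleftrightarrow> x \<in> J"
  by (simp add: cong_def)

lemma cong_refl [simp, intro]: "x \<approx> x"
  by (simp add: cong_def zero_mem)

lemma cong_sym: "x \<approx> y \<Longrightarrow> y \<approx> x"
  using minus_mem[of "x - y"] by (simp add: cong_def)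

lemma cong_trans [trans]: "x \<approx> y \<Longrightarrow> y \<approx> z \<Longrightarrow> x \<approx> z"
  using add_mem[of "x - y" "y - z"] by (simp add: cong_def)

lemma cong_add: "x \<approx> y \<Longrightarrow> x' \<approx> y' \<Longrightarrow> x + x' \<approx> y + y'"
  using add_mem[of "x - y" "x' - y'"] by (simp add: cong_def algebra_simps)

lemma cong_diff: "x \<approx> y \<Longrightarrow> x' \<approx> y' \<Longrightarrow> x - x' \<approx> y - y'"
  using diff_mem[of "x - y" "x' - y'"] by (simp add: cong_def algebra_simps)

lemma cong_mult: "x \<approx> y \<Longrightarrow> x' \<approx> y' \<Longrightarrow> x * x' \<approx> y * y'"
  using add_mem[OF right_mem[of "x - y" x'] left_mem[of "x' - y'" y]]
  by (simp add: cong_def algebra_simps)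

lemma cong_power: "x \<approx> y \<Longrightarrow> x ^ n \<approx> y ^ n"
  by (induction n) (auto intro: cong_mult)

lemma cong_sum: "(\<And>i. i \<in> I \<Longrightarrow> f i \<approx> g i) \<Longrightarrow> sum f I \<approx> sum g I"
  by (induction I rule: infinite_finite_induct) (auto intro: cong_add)

text \<open>The usual induction works up to congruence, since commutation modulo \<open>J\<close>
  already lets \<open>y\<close> pass every power of \<open>d\<close>.\<close>

lemma binomial_cong:
  assumes "d * y \<approx> y * d"
  shows "(d + y) ^ n \<approx> (\<Sum>i\<le>n. of_nat (n choose i) * (d ^ i * y ^ (n - i)))"
proof (induction n)
  case (Suc n)
  have comm: "y * d ^ i \<approx> d ^ i * y" for i
  proof (induction i)
    case (Suc i)
    have "y * d ^ Suc i = (y * d) * d ^ i" by (simp add: mult.assoc)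
    also have "\<dots> \<approx> (d * y) * d ^ i" using cong_mult[OF cong_sym[OF assms] cong_refl] .
    also have "\<dots> = d * (y * d ^ i)" by (simp add: mult.assoc)
    also have "\<dots> \<approx> d * (d ^ i * y)" by (intro cong_mult Suc) auto
    finally show ?case by (simp add: mult.assoc)
  qed simp
  define T where "T i = d ^ i * y ^ (Suc n - i)" for i
  have "(d + y) ^ Suc n = (d + y) * (d + y) ^ n" by simp
  also have "\<dots> \<approx> (d + y) * (\<Sum>i\<le>n. of_nat (n choose i) * (d ^ i * y ^ (n - i)))"
    by (intro cong_mult Suc) auto
  also have "\<dots> = (\<Sum>i\<le>n. of_nat (n choose i) * T (Suc i))
      + (\<Sum>i\<le>n. of_nat (n choose i) * ((y * d ^ i) * y ^ (n - i)))"
    unfolding sum.distrib[symmetric] sum_distrib_left T_def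
  proof (rule sum.cong[OF refl])
    fix i
    have "z * (of_nat (n choose i) * w) = of_nat (n choose i) * (z * w)" for z w :: 'a
      by (metis mult.assoc mult_of_nat_commute)
    then show "(d + y) * (of_nat (n choose i) * (d ^ i * y ^ (n - i))) =
        of_nat (n choose i) * (d ^ Suc i * y ^ (Suc n - Suc i)) +
        of_nat (n choose i) * (y * d ^ i * y ^ (n - i))"
      by (simp add: distrib_right distrib_left mult.assoc)
  qed
  also have "\<dots> \<approx> (\<Sum>i\<le>n. of_nat (n choose i) * T (Suc i))
      + (\<Sum>i\<le>n. of_nat (n choose i) * ((d ^ i * y) * y ^ (n - i)))"
    by (intro cong_add cong_sum cong_mult comm cong_refl)
  also have "(\<Sum>i\<le>n. of_nat (n choose i) * ((d ^ i * y) * y ^ (n - i))) =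
      (\<Sum>i\<le>n. of_nat (n choose i) * T i)"
    unfolding T_def by (intro sum.cong refl) (simp add: mult.assoc Suc_diff_le)
  also have "\<dots> = (\<Sum>i\<le>Suc n. of_nat (n choose i) * T i)" by (simp add: binomial_eq_0)
  also have "\<dots> = T 0 + (\<Sum>i\<le>n. of_nat (n choose Suc i) * T (Suc i))"
    by (subst sum.atMost_Suc_shift) simp
  also have "(\<Sum>i\<le>n. of_nat (n choose i) * T (Suc i)) + \<dots> =
      (\<Sum>i\<le>Suc n. of_nat (Suc n choose i) * T i)"
    by (subst sum.atMost_Suc_shift[of "\<lambda>i. of_nat (Suc n choose i) * T i"]) (simp add: distrib_right sum.distrib)
  finally show ?case by (simp add: T_def)
qed simp

text \<open>Expand \<open>(d + y) ^ t\<close> with \<open>d = x - y\<close> and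
  \<open>t = N * fact k\<close>: \<open>N\<close> divides the binomial coefficients for
  \<open>0 < i \<le> k\<close>, and \<open>d ^ i\<close> lies in \<open>J\<close> for
  \<open>i > k\<close>, so only \<open>y ^ t\<close> survives.\<close>

lemma powers_cong:
  assumes xy: "x * y \<approx> y * x" and nil: "(x - y) ^ k \<in> J" and N: "0 < N" "of_nat N = (0::'a)"
  shows "\<exists>t>0. x ^ t \<approx> y ^ t"
proof (intro exI conjI)
  define d where "d = x - y"
  define t where "t = N * (fact k :: nat)"
  show "t > 0" using N by (simp add: t_def)
  have "d * y \<approx> y * d"
    using xy cong_diff[OF xy cong_refl, of "y * y"] by (simp add: d_def algebra_simps)
  then have "(d + y) ^ t \<approx> (\<Sum>i\<le>t. of_nat (t choose i) * (d ^ i * y ^ (t - i)))"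
    by (rule binomial_cong)
  also have "\<dots> \<approx> (\<Sum>i\<le>t. if i = 0 then y ^ t else 0)"
  proof (rule cong_sum)
    fix i
    consider "i = 0" | "0 < i" "i \<le> k" | "k < i" by linarith
    then show "of_nat (t choose i) * (d ^ i * y ^ (t - i)) \<approx> (if i = 0 then y ^ t else 0)"
    proof cases
      case 2
      then obtain q where "t choose i = N * q" using dvd_binomial_fact N unfolding t_def by blast
      then have "of_nat (t choose i) = (0::'a)" using N by simp
      then show ?thesis using 2 by simp
    next
      case 3
      then have "d ^ i = d ^ k * d ^ (i - k)" by (simp flip: power_add)
      then have "d ^ i \<in> J" using nil right_mem by (simp add: d_def)
      then show ?thesis using 3 by (simp add: cong_0_iff left_mem right_mem)
    qed simp
  qed
  also have "\<dots> = y ^ t" by simp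
  finally show "x ^ t \<approx> y ^ t" by (simp add: d_def)
qed

end

lemma ideal_congruence_zero: "ideal_congruence {0::'a::ring_1}"
  by unfold_locales (simp add: two_sided_ideal_def)

lemma periodic_element_of_nilpotent_diff:
  fixes x :: "'a::ring_1"
  assumes "nilpotent_element (x ^ i - x ^ j)" "0 < i" "0 < j" "i \<noteq> j"
    and N: "0 < N" "of_nat N = (0::'a)"
  shows "periodic_element x"
proof -
  interpret ideal_congruence "{0::'a}" by (rule ideal_congruence_zero)
  obtain k where "(x ^ i - x ^ j) ^ k = 0" using assms(1) by (auto simp: nilpotent_element_def)
  moreover have "x ^ i * x ^ j = x ^ j * x ^ i" by (simp add: add.commute flip: power_add)
  ultimately obtain t where "t > 0" "(x ^ i) ^ t = (x ^ j) ^ t"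
    using powers_cong[of "x ^ i" "x ^ j" k N] N by (auto simp: cong_def)
  then show ?thesis using assms(2-4) unfolding periodic_element_def
    by (intro exI[of _ "i * t"] exI[of _ "j * t"]) (simp add: power_mult)
qed

section \<open>Rings whose non-zero elements have finite multiplicative order\<close>

inductive_set additive_closure :: "'a::monoid_add set \<Rightarrow> 'a set" for S where
  zero: "0 \<in> additive_closure S"
| plus: "x \<in> S \<Longrightarrow> y \<in> additive_closure S \<Longrightarrow> x + y \<in> additive_closure S"

lemma additive_closure_base: "x \<in> S \<Longrightarrow> x \<in> additive_closure S"
  using additive_closure.plus[OF _ additive_closure.zero] by fastforce

lemma additive_closure_add:
  "x \<in> additive_closure S \<Longrightarrow> y \<in> additive_closure S \<Longrightarrow> x + y \<in> additive_closure S"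
  by (induction rule: additive_closure.induct) (auto simp: add.assoc intro: additive_closure.plus)

lemma additive_closure_sum:
  "(\<And>i. i \<in> I \<Longrightarrow> f i \<in> additive_closure S) \<Longrightarrow> sum f I \<in> additive_closure S"
  by (induction I rule: infinite_finite_induct)
    (auto intro: additive_closure.zero additive_closure_add)

lemma additive_closure_mult:
  fixes S T U :: "'a::ring_1 set"
  assumes "\<And>s t. s \<in> S \<Longrightarrow> t \<in> T \<Longrightarrow> s * t \<in> additive_closure U"
    and x: "x \<in> additive_closure S" and y: "y \<in> additive_closure T"
  shows "x * y \<in> additive_closure U"
proof -
  have *: "s * y \<in> additive_closure U" if "s \<in> S" for s
    using y by (induction rule: additive_closure.induct)
      (use assms(1) that in \<open>auto simp: distrib_left intro: additive_closure.zero additive_closure_add\<close>)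
  show ?thesis
    using x by (induction rule: additive_closure.induct)
      (use * in \<open>auto simp: distrib_right intro: additive_closure.zero additive_closure_add\<close>)
qed

lemma additive_closure_commute:
  fixes S T :: "'a::ring_1 set"
  assumes "\<And>s t. s \<in> S \<Longrightarrow> t \<in> T \<Longrightarrow> s * t = t * s"
    and x: "x \<in> additive_closure S" and y: "y \<in> additive_closure T"
  shows "x * y = y * x"
proof -
  have *: "s * y = y * s" if "s \<in> S" for s
    using y by (induction rule: additive_closure.induct)
      (use assms(1) that in \<open>auto simp: distrib_left distrib_right\<close>)
  show ?thesis
    using x by (induction rule: additive_closure.induct)
      (use * in \<open>auto simp: distrib_right distrib_left\<close>)
qed

lemma of_nat_mod_char:
  assumes "of_nat N = (0::'a::ring_1)"
  shows "of_nat (m mod N) = (of_nat m :: 'a)"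
proof -
  have "of_nat m = (of_nat (N * (m div N) + m mod N) :: 'a)" by simp
  then show ?thesis using assms by (simp only: of_nat_add of_nat_mult) simp
qed

text \<open>Coefficients matter only modulo \<open>N\<close>, so every element comes from one of the
  finitely many functions from \<open>S\<close> to \<open>{..<N}\<close>.\<close>

lemma finite_additive_closure:
  fixes S :: "'a::ring_1 set"
  assumes S: "finite S" and N: "0 < N" "of_nat N = (0::'a)"
  shows "finite (additive_closure S)"
proof -
  let ?F = "\<lambda>c. \<Sum>p\<in>S. of_nat (c p) * p"
  have "additive_closure S \<subseteq> ?F ` (S \<rightarrow>\<^sub>E {..<N})"
  proof
    fix x assume "x \<in> additive_closure S"
    then show "x \<in> ?F ` (S \<rightarrow>\<^sub>E {..<N})"
    proof (induction rule: additive_closure.induct)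
      case zero
      have "0 = ?F (restrict (\<lambda>_. 0) S)" by simp
      then show ?case using N by (intro image_eqI[of _ _ "restrict (\<lambda>_. 0) S"]) auto
    next
      case (plus x y)
      then obtain c where c: "c \<in> S \<rightarrow>\<^sub>E {..<N}" "y = ?F c" by auto
      let ?d = "restrict (c(x := (c x + 1) mod N)) S"
      have "?F ?d = (\<Sum>p\<in>S. of_nat (c p) * p + (if p = x then p else 0))"
        by (rule sum.cong) (auto simp: of_nat_mod_char[OF N(2)] distrib_right)
      also have "\<dots> = x + y" using plus(1) S by (simp add: sum.distrib c(2))
      finally have "x + y = ?F ?d" by simp
      then show ?case using N c(1) by (intro image_eqI[of _ _ ?d]) auto
    qed
  qed
  moreover have "finite (S \<rightarrow>\<^sub>E {..<N})" using S by (simp add: finite_PiE)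
  ultimately show ?thesis by (rule finite_surj[rotated])
qed

lemma power_mod_order:
  fixes x :: "'a::monoid_mult"
  assumes "x ^ n = 1" shows "x ^ (m mod n) = x ^ m"
proof -
  have "x ^ m = x ^ (n * (m div n) + m mod n)" by simp
  also have "\<dots> = x ^ (m mod n)" using assms by (simp only: power_add power_mult) simp
  finally show ?thesis by simp
qed

locale torsion_units =
  fixes T :: "'a::ring_1 itself"
  assumes power_eq_1: "(x::'a) \<noteq> 0 \<Longrightarrow> \<exists>n>0. x ^ n = 1"
begin

text \<open>The inverse is itself a power of \<open>x\<close>, so it stays in every multiplicative
  submonoid containing \<open>x\<close>, in particular in \<open>L\<close> below.\<close>

lemma inverse_ex:
  assumes "(x::'a) \<noteq> 0"
  obtains n where "x * x ^ n = 1" "x ^ n * x = 1"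
proof -
  obtain n where "n > 0" "x ^ n = 1" using power_eq_1[OF assms] by blast
  then show ?thesis by (intro that[of "n - 1"]) (simp_all flip: power_Suc power_Suc2)
qed

lemma mult_eq_0: "(x::'a) * y = 0 \<Longrightarrow> x = 0 \<or> y = 0"
proof (rule disjCI)
  assume "x * y = 0" "y \<noteq> 0"
  obtain n where "y * y ^ n = 1" using inverse_ex[OF \<open>y \<noteq> 0\<close>] by blast
  then have "x = x * y * y ^ n" by (simp add: mult.assoc)
  then show "x = 0" using \<open>x * y = 0\<close> by simp
qed

lemma mult_geometric_sum: "((x::'a) - 1) * (\<Sum>i<n. x ^ i) = x ^ n - 1"
  by (induction n) (simp_all add: algebra_simps)

lemma right_cancel: "(x::'a) * z = y * z \<Longrightarrow> z \<noteq> 0 \<Longrightarrow> x = y"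
  using mult_eq_0[of "x - y" z] by (simp add: left_diff_distrib)

lemma left_cancel: "z * (x::'a) = z * y \<Longrightarrow> z \<noteq> 0 \<Longrightarrow> x = y"
  using mult_eq_0[of z "x - y"] by (simp add: right_diff_distrib)

lemma power_eq_0: "(x::'a) ^ n = 0 \<Longrightarrow> x = 0"
  by (induction n) (use mult_eq_0 in auto)

lemma char_ex: obtains N where "0 < N" "of_nat N = (0::'a)"
proof (cases "(2::'a) = 0")
  case True
  then show ?thesis by (intro that[of 2]) simp_all
next
  case False
  then obtain n where n: "n > 0" "(2::'a) ^ n = 1" using power_eq_1 by blast
  have "(2::nat) ^ n > 1" using n(1) by (rule one_less_power[rotated]) simp
  then have "of_nat (2 ^ n - 1) = (2::'a) ^ n - 1" by (simp add: of_nat_diff)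
  then show ?thesis using n \<open>(2::nat) ^ n > 1\<close> by (intro that[of "2 ^ n - 1"]) simp_all
qed

text \<open>Vandermonde: multiplying the equations by \<open>f j\<close> and subtracting eliminates the index \<open>j\<close>.\<close>

lemma vandermonde:
  fixes f e :: "'i \<Rightarrow> 'a"
  assumes "finite I" and "inj_on f I" and "\<And>i j. i \<in> I \<Longrightarrow> j \<in> I \<Longrightarrow> f i * f j = f j * f i"
    and "\<And>t. (\<Sum>i\<in>I. f i ^ t * e i) = 0" and "i \<in> I"
  shows "e i = 0"
  using assms
proof (induction I arbitrary: e i)
  case empty
  then show ?case by simp
next
  case (insert j I)
  have comm: "f j * f i ^ t = f i ^ t * f j" if "i \<in> I" for i t
    using insert.prems(2)[of j i] that by (intro power_commuting_commutes[symmetric]) auto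
  have z: "e i = 0" if "i \<in> I" for i
  proof -
    have "(\<Sum>i\<in>I. f i ^ t * ((f i - f j) * e i)) = 0" for t
    proof -
      have "(\<Sum>i\<in>I. f i ^ t * ((f i - f j) * e i)) =
          (\<Sum>i\<in>insert j I. f i ^ t * ((f i - f j) * e i))"
        using insert.hyps by simp
      also have "\<dots> = (\<Sum>i\<in>insert j I. f i ^ Suc t * e i - f j * (f i ^ t * e i))"
      proof (rule sum.cong[OF refl])
        fix i assume "i \<in> insert j I"
        then have "f j * f i ^ t = f i ^ t * f j" using comm by (auto simp: power_commutes)
        then have "f j * (f i ^ t * e i) = f i ^ t * f j * e i" by (metis mult.assoc)
        then show "f i ^ t * ((f i - f j) * e i) = f i ^ Suc t * e i - f j * (f i ^ t * e i)"
          by (simp add: algebra_simps power_commutes flip: mult.assoc)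
      qed
      also have "\<dots> = 0"
        unfolding sum_subtractf sum_distrib_left[symmetric] insert.prems(3) by simp
      finally show ?thesis .
    qed
    from insert.IH[OF _ _ this that] insert.prems(1,2) have "(f i - f j) * e i = 0" by auto
    moreover have "f i \<noteq> f j" using insert that by (auto simp: inj_on_def)
    ultimately show ?thesis using mult_eq_0 by fastforce
  qed
  moreover have "e j = 0" using insert.prems(3)[of 0] insert.hyps z by simp
  ultimately show ?case using insert.prems(4) by blast
qed

end

section \<open>A non-commuting pair with \<open>b * a = a ^ k * b\<close>, refuted by
  counting\<close>

locale twisted_pair = torsion_units T for T :: "'a::ring_1 itself" +
  fixes a b :: 'a and k :: nat
  assumes ba: "b * a = a ^ k * b" and noncomm: "b * a \<noteq> a * b"
begin

lemma a_nz: "a \<noteq> 0" and b_nz: "b \<noteq> 0" using noncomm by auto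

text \<open>The order of conjugation by \<open>b\<close> on the ring generated by
  \<open>a\<close>.\<close>

definition r :: nat where "r = (LEAST r. r > 0 \<and> b ^ r * a = a * b ^ r)"

lemma r_props: "r > 0" "b ^ r * a = a * b ^ r"
proof -
  obtain n where "n > 0" "b ^ n = 1" using power_eq_1[OF b_nz] by blast
  then have "\<exists>r. r > 0 \<and> b ^ r * a = a * b ^ r" by (intro exI[of _ n]) simp
  from LeastI_ex[OF this] show "r > 0" "b ^ r * a = a * b ^ r" by (simp_all add: r_def)
qed

lemma r_least: "i > 0 \<Longrightarrow> i < r \<Longrightarrow> b ^ i * a \<noteq> a * b ^ i"
  using not_less_Least[of i "\<lambda>r. r > 0 \<and> b ^ r * a = a * b ^ r"] by (auto simp: r_def)

definition S :: "'a set" where "S = (\<lambda>(i, j). a ^ i * (b ^ r) ^ j) ` UNIV"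

text \<open>The monomials in \<open>S\<close> commute, and \<open>L\<close> is the finite field
  generated by \<open>a\<close> and \<open>b ^ r\<close>.\<close>

definition L :: "'a set" where "L = additive_closure S"

lemma brj_comm: "(b ^ r) ^ j * a ^ i = a ^ i * (b ^ r) ^ j"
proof -
  have "(b ^ r) ^ j * a = a * (b ^ r) ^ j" using r_props(2) by (rule power_commuting_commutes)
  then show ?thesis by (rule power_commuting_commutes[OF sym, symmetric])
qed

lemma S_mult: "(a ^ i * (b ^ r) ^ j) * (a ^ i' * (b ^ r) ^ j') = a ^ (i + i') * (b ^ r) ^ (j + j')"
proof -
  have "(a ^ i * (b ^ r) ^ j) * (a ^ i' * (b ^ r) ^ j') = a ^ i * ((b ^ r) ^ j * a ^ i') * (b ^ r) ^ j'"
    by (simp only: mult.assoc)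
  also have "\<dots> = a ^ (i + i') * (b ^ r) ^ (j + j')"
    by (simp only: brj_comm mult.assoc power_add)
  finally show ?thesis .
qed

lemma S_I: "a ^ i * (b ^ r) ^ j \<in> S" by (auto simp: S_def)

lemma S_finite: "finite S"
proof -
  obtain m where m: "m > 0" "a ^ m = 1" using power_eq_1[OF a_nz] by blast
  have "b ^ r \<noteq> 0" using power_eq_0 b_nz by blast
  then obtain n where n: "n > 0" "(b ^ r) ^ n = 1" using power_eq_1 by blast
  have "S \<subseteq> (\<lambda>(i, j). a ^ i * (b ^ r) ^ j) ` ({..<m} \<times> {..<n})"
  proof
    fix x assume "x \<in> S"
    then obtain i j where "x = a ^ i * (b ^ r) ^ j" by (auto simp: S_def)
    then have "x = a ^ (i mod m) * (b ^ r) ^ (j mod n)"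
      using power_mod_order[OF m(2), of i] power_mod_order[OF n(2), of j] by simp
    then show "x \<in> (\<lambda>(i, j). a ^ i * (b ^ r) ^ j) ` ({..<m} \<times> {..<n})"
      using m(1) n(1) by (intro image_eqI[of _ _ "(i mod m, j mod n)"]) auto
  qed
  then show ?thesis by (rule finite_subset) simp
qed

lemma L_finite: "finite L"
  using char_ex finite_additive_closure[OF S_finite] unfolding L_def by metis

lemma L_S: "x \<in> S \<Longrightarrow> x \<in> L" by (simp add: L_def additive_closure_base)

lemma L_sum: "(\<And>i. i \<in> I \<Longrightarrow> f i \<in> L) \<Longrightarrow> sum f I \<in> L"
  unfolding L_def by (rule additive_closure_sum)

lemma L_mult: "x \<in> L \<Longrightarrow> y \<in> L \<Longrightarrow> x * y \<in> L"
  unfolding L_def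
  by (rule additive_closure_mult[of S S S]) (auto simp: S_def S_mult intro!: additive_closure_base S_I[unfolded S_def])

lemma L_comm: "x \<in> L \<Longrightarrow> y \<in> L \<Longrightarrow> x * y = y * x"
  unfolding L_def
  by (rule additive_closure_commute[of S S])
    (auto simp only: S_def S_mult add.commute split: prod.splits)

lemma L_a: "a \<in> L" and L_one: "1 \<in> L" and L_br: "b ^ r \<in> L"
  using L_S[OF S_I[of 1 0]] L_S[OF S_I[of 0 0]] L_S[OF S_I[of 0 1]] by simp_all

lemma L_power: "x \<in> L \<Longrightarrow> x ^ n \<in> L"
  by (induction n) (auto intro: L_one L_mult)

lemma L_inverse:
  assumes "x \<in> L" "x \<noteq> 0" obtains y where "y \<in> L" "y \<noteq> 0" "x * y = 1" "y * x = 1"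
proof -
  obtain n where n: "x * x ^ n = 1" "x ^ n * x = 1" using inverse_ex[OF assms(2)] by blast
  moreover have "x ^ n \<noteq> 0" using n by auto
  ultimately show ?thesis using L_power[OF assms(1)] that by blast
qed

text \<open>Conjugation by \<open>b\<close> sends \<open>a ^ i\<close> to \<open>a ^ (k * i)\<close>
  and fixes \<open>b ^ r\<close>, so it permutes monomials. The element \<open>y\<close> stands for
  \<open>b x b^{-1}\<close>.\<close>

lemma conj_ex: "x \<in> L \<Longrightarrow> \<exists>y\<in>L. b * x = y * b"
  unfolding L_def
proof (induction rule: additive_closure.induct)
  case zero
  show ?case by (rule bexI[of _ 0]) (auto intro: additive_closure.zero)
next
  case (plus x y)
  obtain i j where x: "x = a ^ i * (b ^ r) ^ j" using plus(1) by (auto simp: S_def)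
  have bai: "b * a ^ i = a ^ (k * i) * b" for i
  proof (induction i)
    case (Suc i)
    have "b * a ^ Suc i = b * a ^ i * a" by (simp add: power_commutes mult.assoc)
    also have "\<dots> = a ^ (k * i) * (b * a)" by (simp add: Suc mult.assoc)
    also have "\<dots> = a ^ (k * Suc i) * b" by (simp add: ba mult.assoc[symmetric] add.commute flip: power_add)
    finally show ?case .
  qed simp
  have "b * (b ^ r) ^ j = (b ^ r) ^ j * b"
    by (metis power_commutes power_commuting_commutes)
  then have "b * x = (a ^ (k * i) * (b ^ r) ^ j) * b"
    unfolding x by (metis bai mult.assoc)
  moreover obtain z where "z \<in> additive_closure S" "b * y = z * b" using plus by blast
  ultimately show ?case using plus(1) S_I
    by (intro bexI[of _ "a ^ (k * i) * (b ^ r) ^ j + z"])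
      (auto simp: distrib_left distrib_right intro: additive_closure.plus)
qed

lemma conj_power_ex: "x \<in> L \<Longrightarrow> \<exists>y\<in>L. b ^ i * x = y * b ^ i"
proof (induction i)
  case (Suc i)
  then obtain y where y: "y \<in> L" "b ^ i * x = y * b ^ i" by blast
  obtain z where z: "z \<in> L" "b * y = z * b" using conj_ex[OF y(1)] by blast
  have "b ^ Suc i * x = b * (b ^ i * x)" by (simp add: mult.assoc)
  also have "\<dots> = z * b ^ Suc i" by (simp add: y(2) z(2) flip: mult.assoc)
  finally show ?case using z by blast
qed auto

text \<open>The Galois conjugate \<open>b^i a b^{-i}\<close> of \<open>a\<close>.\<close>

definition conj_a :: "nat \<Rightarrow> 'a" where "conj_a i = (SOME y. y \<in> L \<and> b ^ i * a = y * b ^ i)"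

lemma conj_a: "conj_a i \<in> L" "b ^ i * a = conj_a i * b ^ i"
proof -
  have "\<exists>y. y \<in> L \<and> b ^ i * a = y * b ^ i" using conj_power_ex[OF L_a] by blast
  from someI_ex[OF this] show "conj_a i \<in> L" "b ^ i * a = conj_a i * b ^ i"
    by (simp_all add: conj_a_def)
qed

lemma conj_a_power: "b ^ i * a ^ t = conj_a i ^ t * b ^ i"
proof (induction t)
  case (Suc t)
  have "b ^ i * a ^ Suc t = b ^ i * a * a ^ t" by (simp add: mult.assoc)
  also have "\<dots> = conj_a i * (b ^ i * a ^ t)" by (simp add: conj_a mult.assoc)
  finally show ?case by (simp add: Suc mult.assoc)
qed simp

text \<open>If two conjugates agree for \<open>i < j\<close>, cancelling \<open>b ^ i\<close> makes
  \<open>b ^ (j - i)\<close> commute with \<open>a\<close>, against the minimality of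
  \<open>r\<close>.\<close>

lemma conj_a_inj: "inj_on conj_a {..<r}"
proof (rule linorder_inj_onI)
  fix i j assume *: "i < j" "i \<in> {..<r}" "j \<in> {..<r}"
  show "conj_a i \<noteq> conj_a j"
  proof
    assume eq: "conj_a i = conj_a j"
    have "b ^ i * (b ^ (j - i) * a) = b ^ j * a" using * by (simp flip: mult.assoc power_add)
    also have "\<dots> = conj_a i * b ^ i * b ^ (j - i)"
      using * by (simp add: conj_a(2) eq mult.assoc flip: power_add)
    also have "\<dots> = b ^ i * (a * b ^ (j - i))" by (simp flip: conj_a(2) mult.assoc)
    finally have "b ^ (j - i) * a = a * b ^ (j - i)"
      by (rule left_cancel) (use power_eq_0 b_nz in blast)
    moreover have "j - i > 0" "j - i < r" using * by auto
    ultimately show False using r_least by blast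
  qed
qed auto

text \<open>The coset of the group \<open>L - {0}\<close> through \<open>b\<close>; its elements act
  on \<open>L\<close> by conjugation exactly as \<open>b\<close> does.\<close>

definition X :: "'a set" where "X = (\<lambda>w. w * b) ` (L - {0})"

text \<open>The multiplicative group of the fixed field of this action.\<close>

definition K :: "'a set" where "K = {w \<in> L - {0}. w * b = b * w}"

lemma X_nz: "u \<in> X \<Longrightarrow> u \<noteq> 0"
  using mult_eq_0 b_nz by (auto simp: X_def)

lemma X_power: "u \<in> X \<Longrightarrow> \<exists>w\<in>L - {0}. u ^ i = w * b ^ i"
proof (induction i)
  case 0
  then show ?case using L_one by (intro bexI[of _ 1]) auto
next
  case (Suc i)
  then obtain w where w: "w \<in> L - {0}" "u ^ i = w * b ^ i" by blast
  obtain z where z: "z \<in> L - {0}" "u = z * b" using Suc.prems by (auto simp: X_def)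
  obtain y where y: "y \<in> L" "b * w = y * b" using conj_ex w by blast
  have "y \<noteq> 0" using y(2) w(1) b_nz mult_eq_0[of b w] by auto
  have "u ^ Suc i = z * (b * w) * b ^ i" by (simp only: power_Suc w(2)) (simp add: z mult.assoc)
  also have "\<dots> = (z * y) * b ^ Suc i" by (simp add: y mult.assoc)
  finally show ?case using z y \<open>y \<noteq> 0\<close> mult_eq_0 L_mult by blast
qed

lemma X_power_a: "u \<in> X \<Longrightarrow> u ^ i * a ^ t = conj_a i ^ t * u ^ i"
proof -
  assume "u \<in> X"
  then obtain w where w: "w \<in> L" "u ^ i = w * b ^ i" using X_power by blast
  have "u ^ i * a ^ t = w * conj_a i ^ t * b ^ i" by (simp add: w mult.assoc conj_a_power)
  also have "w * conj_a i ^ t = conj_a i ^ t * w" using L_comm L_power w conj_a by blast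
  finally show ?thesis by (simp add: w mult.assoc)
qed

lemma X_power_r_L: "u \<in> X \<Longrightarrow> u ^ r \<in> L"
  using X_power[of u r] L_mult L_br by auto

text \<open>For \<open>u = w * b\<close>, \<open>u ^ r\<close> is the norm of \<open>w\<close> times
  \<open>b ^ r\<close>. It commutes with \<open>w\<close>, as both lie in \<open>L\<close>, and with
  \<open>u\<close>; cancelling \<open>w\<close> shows that it commutes with
  \<open>b\<close>.\<close>

lemma X_power_r_K: assumes "u \<in> X" shows "u ^ r \<in> K"
proof -
  obtain w where w: "w \<in> L" "w \<noteq> 0" "u = w * b" using assms by (auto simp: X_def)
  have "w * (u ^ r * b) = u ^ r * u" by (metis L_comm X_power_r_L assms mult.assoc w(1,3))
  also have "\<dots> = u * u ^ r" by (simp add: power_commutes)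
  also have "\<dots> = w * (b * u ^ r)" by (simp add: w mult.assoc)
  finally have "u ^ r * b = b * u ^ r" using left_cancel w(2) by blast
  moreover have "u ^ r \<noteq> 0" using power_eq_0 X_nz assms by blast
  ultimately show ?thesis using X_power_r_L[OF assms] by (simp add: K_def)
qed

lemma conj_a_vandermonde:
  assumes "\<And>t. (\<Sum>i<r. conj_a i ^ t * e i) = 0" "i < r" shows "e i = 0"
  by (rule vandermonde[of "{..<r}" conj_a]) (use assms conj_a_inj conj_a L_comm in auto)

text \<open>Since \<open>u\<close> does not commute with \<open>a\<close>, it differs from 1, so
  \<open>u ^ r = 1\<close> would make the sum of the \<open>u ^ i\<close> vanish. Moving
  \<open>a ^ t\<close> to the left in this sum gives a Vandermonde system that forces
  \<open>u ^ 0 = 0\<close>.\<close>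

lemma X_power_r_neq_1: assumes u: "u \<in> X" shows "u ^ r \<noteq> 1"
proof
  assume 1: "u ^ r = 1"
  obtain w where w: "w \<in> L" "w \<noteq> 0" "u = w * b" using u by (auto simp: X_def)
  have "u \<noteq> 1"
  proof
    assume "u = 1"
    then have "w * (b * a) = w * (a * b)" using w L_comm[OF w(1) L_a]
      by (metis mult.assoc mult.left_neutral mult.right_neutral)
    then show False using left_cancel w(2) noncomm by blast
  qed
  have "(u - 1) * (\<Sum>i<r. u ^ i) = u ^ r - 1" by (rule mult_geometric_sum)
  then have "(\<Sum>i<r. u ^ i) = 0" using 1 \<open>u \<noteq> 1\<close> mult_eq_0[of "u - 1"] by auto
  then have "(\<Sum>i<r. u ^ i) * a ^ t = 0" for t by simp
  then have "(\<Sum>i<r. conj_a i ^ t * u ^ i) = 0" for t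
    by (simp add: sum_distrib_right X_power_a[OF u])
  from conj_a_vandermonde[OF this r_props(1)] show False by simp
qed

text \<open>A form of Hilbert's Theorem 90, with the averaging operator as witness.\<close>

lemma X_power_r_eq:
  assumes u: "u \<in> X" and v: "v \<in> X" and eq: "u ^ r = v ^ r"
  shows "\<exists>w\<in>L - {0}. u * w = w * v"
proof -
  obtain v' n where v': "v * v' = 1" "v' * v = 1" "v' = v ^ n"
    using inverse_ex[OF X_nz[OF v]] by metis
  have vv: "v ^ i * v' ^ i = 1" for i
    by (metis v'(1,2) left_right_inverse_power)
  define w where "w t = (\<Sum>i<r. u ^ i * a ^ t * v' ^ i)" for t
  have w_alt: "w t = (\<Sum>i<r. conj_a i ^ t * (u ^ i * v' ^ i))" for t
    by (simp add: w_def X_power_a[OF u] mult.assoc)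
  \<comment> \<open>If every \<open>w t\<close> vanished, the Vandermonde system would force its
    coefficient at index 0, which is 1, to vanish.\<close>
  obtain t where t: "w t \<noteq> 0"
    using conj_a_vandermonde[OF _ r_props(1), of "\<lambda>i. u ^ i * v' ^ i"] w_alt by fastforce
  have "u ^ i * v' ^ i \<in> L" for i
  proof -
    obtain x where x: "x \<in> L" "u ^ i = x * b ^ i" using X_power[OF u] by blast
    obtain y where y: "y \<in> L" "y \<noteq> 0" "v ^ i = y * b ^ i" using X_power[OF v] by blast
    obtain z where z: "z \<in> L" "z * y = 1" using L_inverse[OF y(1,2)] by blast
    have "u ^ i = x * (z * (y * b ^ i))" using x z by (simp flip: mult.assoc)
    then have "u ^ i * v' ^ i = x * z * (v ^ i * v' ^ i)" by (simp add: y(3) mult.assoc)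
    then show ?thesis using vv x z L_mult by simp
  qed
  then have wL: "w t \<in> L" unfolding w_alt by (meson L_sum L_mult L_power conj_a(1))
  \<comment> \<open>Multiplying by \<open>u\<close> and \<open>v'\<close> shifts the summation index
    by one; the boundary terms agree because \<open>u ^ r = v ^ r\<close> commutes with
    \<open>a ^ t\<close>.\<close>
  have "u * w t * v' = (\<Sum>i<r. u ^ Suc i * a ^ t * v' ^ Suc i)"
    by (simp add: w_def sum_distrib_left sum_distrib_right mult.assoc power_commutes)
  also have "\<dots> + u ^ 0 * a ^ t * v' ^ 0 = (\<Sum>i<Suc r. u ^ i * a ^ t * v' ^ i)"
    by (subst sum.lessThan_Suc_shift) simp
  also have "\<dots> = w t + u ^ r * a ^ t * v' ^ r" by (simp add: w_def)
  also have "u ^ r * a ^ t * v' ^ r = a ^ t * (v ^ r * v' ^ r)"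
    using L_comm[OF X_power_r_L[OF u] L_power[OF L_a]] by (simp add: eq mult.assoc)
  finally have "u * w t * v' = w t" by (simp add: vv)
  then have "u * w t = w t * v" by (metis mult.assoc v'(2) mult.right_neutral)
  then show ?thesis using t wL by blast
qed

text \<open>The map \<open>u \<mapsto> u ^ r\<close> sends \<open>X\<close>, which has as many elements as \<open>L - {0}\<close>, into \<open>K - {1}\<close>,
  and each fibre lies in a single orbit of \<open>L - {0}\<close> acting by conjugation with stabilizer \<open>K\<close>.\<close>

lemma contradiction: False
proof -
  \<comment> \<open>\<open>V\<close> selects one element of each fibre, and \<open>W u\<close> below
    conjugates \<open>u\<close> to the selected element of its own fibre.\<close>
  define V where "V y = (SOME v. v \<in> X \<and> v ^ r = y)" for y
  have V: "V (u ^ r) \<in> X" "V (u ^ r) ^ r = u ^ r" if "u \<in> X" for u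
    using someI[of "\<lambda>v. v \<in> X \<and> v ^ r = u ^ r" u] that by (auto simp: V_def)
  have "\<exists>w. w \<in> L - {0} \<and> u * w = w * V (u ^ r)" if "u \<in> X" for u
    using X_power_r_eq[OF that V(1)[OF that]] V(2)[OF that] by auto
  then obtain W where W: "\<And>u. u \<in> X \<Longrightarrow> W u \<in> L - {0}"
    "\<And>u. u \<in> X \<Longrightarrow> u * W u = W u * V (u ^ r)" by metis
  let ?f = "\<lambda>(u, x). (u ^ r, W u * x)"
  have "inj_on ?f (X \<times> K)"
  proof (rule inj_onI, clarify)
    fix u x u' x'
    assume *: "u \<in> X" "u' \<in> X" "x \<in> K" "x' \<in> K" "u ^ r = u' ^ r" "W u * x = W u' * x'"
    \<comment> \<open>Elements of \<open>K\<close> commute with \<open>V (u ^ r)\<close>, so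
      \<open>W u * x\<close> also conjugates \<open>u\<close> to it; hence \<open>u\<close> can be
      recovered from its image under \<open>?f\<close>.\<close>
    have key: "u * (W u * x) = W u * x * V (u ^ r)" if ux: "u \<in> X" "x \<in> K" for u x
    proof -
      obtain z where z: "z \<in> L" "V (u ^ r) = z * b" using V(1)[OF ux(1)] unfolding X_def by blast
      have x: "x \<in> L" "x * b = b * x" using ux(2) by (auto simp: K_def)
      have "x * V (u ^ r) = z * (x * b)" by (simp add: z(2) L_comm[OF x(1) z(1)] flip: mult.assoc)
      also have "\<dots> = V (u ^ r) * x" by (simp only: x(2) z(2) mult.assoc)
      finally have "W u * x * V (u ^ r) = (W u * V (u ^ r)) * x" by (simp only: mult.assoc)
      also have "\<dots> = u * (W u * x)" by (simp only: W(2)[OF ux(1), symmetric] mult.assoc)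
      finally show ?thesis by simp
    qed
    have nz: "W u * x \<noteq> 0" using W(1)[OF *(1)] *(3) mult_eq_0 by (auto simp: K_def)
    have "u * (W u * x) = u' * (W u * x)" using key[OF *(1,3)] key[OF *(2,4)] *(5,6) by simp
    then have "u = u'" using nz right_cancel by blast
    moreover have "x = x'" using *(6) W(1)[OF *(1)] left_cancel unfolding \<open>u = u'\<close> by blast
    ultimately show "u = u' \<and> x = x'" by simp
  qed
  moreover have "?f ` (X \<times> K) \<subseteq> (K - {1}) \<times> (L - {0})"
    using X_power_r_K X_power_r_neq_1 W(1) L_mult mult_eq_0 by (auto simp: K_def) blast+
  moreover have "finite K" using L_finite by (simp add: K_def)
  \<comment> \<open>As \<open>X\<close> and \<open>L - {0}\<close> have the same size, this would
    give \<open>card K \<le> card K - 1\<close>.\<close>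
  ultimately have "card (X \<times> K) \<le> card ((K - {1}) \<times> (L - {0}))"
    using L_finite by (intro card_inj_on_le[of ?f]) auto
  moreover have "card X = card (L - {0})"
    unfolding X_def by (rule card_image) (auto simp: inj_on_def dest!: right_cancel[OF _ b_nz])
  moreover have "1 \<in> K" using L_one by (simp add: K_def)
  moreover have "card (L - {0}) > 0" using L_finite L_one by (auto simp: card_gt_0_iff)
  moreover have "card K > 0" using \<open>1 \<in> K\<close> \<open>finite K\<close> by (auto simp: card_gt_0_iff)
  ultimately show False by (simp add: card_cartesian_product)
qed

end

section \<open>Commutativity when all non-zero elements have finite order\<close>

context torsion_units
begin

lemma prime_char:
  "n > 0 \<Longrightarrow> of_nat n = (0::'a) \<Longrightarrow> \<exists>p. prime p \<and> p dvd n \<and> of_nat p = (0::'a)"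
proof (induction n rule: less_induct)
  case (less n)
  then have "n \<noteq> 1" by auto
  then obtain p where p: "prime p" "p dvd n" using prime_factor_nat by blast
  then obtain m where m: "n = p * m" by blast
  show ?case
  proof (cases "of_nat p = (0::'a)")
    case False
    then have "of_nat m = (0::'a)" using less.prems m mult_eq_0 by fastforce
    moreover have "0 < m" "m < n" using less.prems m prime_gt_1_nat[OF p(1)] by auto
    ultimately show ?thesis using less.IH m by (metis dvd_mult)
  qed (use p in blast)
qed

text \<open>Otherwise some prime \<open>p\<close> dividing \<open>n\<close> is zero in the ring.
  With \<open>n = m * p\<close>, Frobenius gives \<open>(a ^ m - 1) ^ p = a ^ n - 1 = 0\<close>, so
  \<open>a ^ m = 1\<close> against the minimality of \<open>n\<close>.\<close>

lemma order_invertible: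
  assumes n: "n > 0" "(a::'a) ^ n = 1" and least: "\<And>i. 0 < i \<Longrightarrow> i < n \<Longrightarrow> a ^ i \<noteq> 1"
  shows "of_nat n \<noteq> (0::'a)"
proof
  assume "of_nat n = (0::'a)"
  then obtain p where p: "prime p" "p dvd n" "of_nat p = (0::'a)" using prime_char n by blast
  then obtain m where m: "n = m * p" by (metis dvd_def mult.commute)
  have m': "0 < m" "m < n" using n m prime_gt_1_nat[OF p(1)] by auto
  define d where "d = a ^ m - 1"
  interpret ideal_congruence "{0::'a}" by (rule ideal_congruence_zero)
  have "cong ((d + 1) ^ p) (\<Sum>i\<le>p. of_nat (p choose i) * (d ^ i * 1 ^ (p - i)))"
    by (rule binomial_cong) simp
  then have "(d + 1) ^ p = (\<Sum>i\<le>p. of_nat (p choose i) * d ^ i)" by (simp add: cong_def)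
  also have "\<dots> = (\<Sum>i\<le>p. (if i = 0 then 1 else 0) + (if i = p then d ^ p else 0))"
  proof (rule sum.cong[OF refl])
    fix i assume "i \<in> {..p}"
    have "of_nat (p choose i) = (0::'a)" if "0 < i" "i < p"
      using dvd_choose_prime[OF _ _ _ p(1), of i] that p(3) by (auto elim!: dvdE)
    then show "of_nat (p choose i) * d ^ i = (if i = 0 then 1 else 0) + (if i = p then d ^ p else 0)"
      using \<open>i \<in> {..p}\<close> prime_gt_1_nat[OF p(1)] by auto
  qed
  also have "\<dots> = 1 + d ^ p" by (simp add: sum.distrib)
  finally have "d ^ p = 0" using n(2) by (simp add: d_def m power_mult)
  then have "a ^ m = 1" using power_eq_0[of d p] by (simp add: d_def)
  then show False using least m' by blast
qed

theorem commutative: "(x::'a) * a = a * x"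
proof (rule ccontr)
  assume noncomm: "x * a \<noteq> a * x"
  then have "a \<noteq> 0" by auto
  define n where "n = (LEAST n. n > 0 \<and> a ^ n = 1)"
  have n: "n > 0" "a ^ n = 1"
    using LeastI_ex[OF power_eq_1[OF \<open>a \<noteq> 0\<close>]] by (simp_all add: n_def)
  have least: "a ^ i \<noteq> 1" if "0 < i" "i < n" for i
    using not_less_Least[of i "\<lambda>n. n > 0 \<and> a ^ n = 1"] that by (auto simp: n_def)
  \<comment> \<open>\<open>n\<close> is invertible and \<open>n * x\<close> is the sum of the eigenvectors \<open>Q j\<close> of conjugation by \<open>a\<close>, so some
    \<open>Q j\<close> does not commute with \<open>a\<close>.\<close>
  define Q where "Q j = (\<Sum>i<n. (a ^ i) ^ j * x * a ^ i)" for j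
  \<comment> \<open>The exponent \<open>(n - 1) * j\<close> represents \<open>- j\<close> modulo
    \<open>n\<close>.\<close>
  have twist: "Q j * a = a ^ ((n - 1) * j) * Q j" for j
  proof -
    have "(a ^ Suc i) ^ j = a ^ j * (a ^ i) ^ j" for i
      by (simp only: power_mult[symmetric] mult_Suc power_add)
    then have "a ^ j * (Q j * a) = (\<Sum>i<n. (a ^ Suc i) ^ j * x * a ^ Suc i)"
      unfolding Q_def sum_distrib_left sum_distrib_right
      by (intro sum.cong refl)
        (simp only: mult.assoc power_Suc2)
    also have "\<dots> + x = (\<Sum>i<Suc n. (a ^ i) ^ j * x * a ^ i)"
      by (subst sum.lessThan_Suc_shift) simp
    also have "\<dots> = Q j + x" by (simp add: Q_def n)
    finally have "a ^ ((n - 1) * j) * Q j = (a ^ ((n - 1) * j) * a ^ j) * (Q j * a)"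
      by (simp add: mult.assoc)
    also have "a ^ ((n - 1) * j) * a ^ j = a ^ (n * j)"
      using n(1) by (cases n) (simp_all add: add.commute[of j] flip: power_add)
    also have "\<dots> = 1" using n by (simp add: power_mult)
    finally show ?thesis by simp
  qed
  have "Q j * a = a * Q j" for j
  proof (rule ccontr)
    assume "Q j * a \<noteq> a * Q j"
    then interpret twisted_pair T a "Q j" "(n - 1) * j"
      by unfold_locales (use twist in auto)
    show False by (rule contradiction)
  qed
  then have "(\<Sum>j<n. Q j) * a = a * (\<Sum>j<n. Q j)"
    by (simp add: sum_distrib_left sum_distrib_right)
  also have "(\<Sum>j<n. Q j) = of_nat n * x"
  proof -
    have "(\<Sum>j<n. Q j) = (\<Sum>i<n. (\<Sum>j<n. (a ^ i) ^ j) * x * a ^ i)"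
      unfolding Q_def by (subst sum.swap) (simp add: sum_distrib_right)
    \<comment> \<open>For \<open>0 < i < n\<close>, \<open>a ^ i\<close> is an \<open>n\<close>-th
      root of unity other than 1, so its geometric sum vanishes.\<close>
    also have "\<dots> = (\<Sum>i<n. if i = 0 then of_nat n * x else 0)"
    proof (rule sum.cong[OF refl])
      fix i assume i: "i \<in> {..<n}"
      have "(\<Sum>j<n. (a ^ i) ^ j) = 0" if "i \<noteq> 0"
      proof -
        have "(a ^ i) ^ n = 1" by (subst power_mult[symmetric], subst mult.commute) (simp add: power_mult n)
        then have "(a ^ i - 1) * (\<Sum>j<n. (a ^ i) ^ j) = 0" by (simp add: mult_geometric_sum)
        moreover have "a ^ i - 1 \<noteq> 0" using least[of i] that i by simp
        ultimately show ?thesis using mult_eq_0[of "a ^ i - 1"] by blast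
      qed
      then show "(\<Sum>j<n. (a ^ i) ^ j) * x * a ^ i = (if i = 0 then of_nat n * x else 0)" by simp
    qed
    also have "\<dots> = of_nat n * x" using n by simp
    finally show ?thesis .
  qed
  finally have "of_nat n * (x * a) = of_nat n * (a * x)"
    by (simp only: mult.assoc[symmetric] mult_of_nat_commute[of n a])
  then have "x * a = a * x" by (rule left_cancel) (rule order_invertible[OF n least])
  with noncomm show False by blast
qed

end

section \<open>Commutativity of periodic rings modulo the nilpotent elements\<close>

text \<open>Only one ideal per type can be divided out this way, so the ideal is chosen to be a
  counterexample to the commutativity theorem below, if there is one.\<close>

definition bad_ideal :: "'a::ring_1 set \<Rightarrow> bool" where
  "bad_ideal I \<longleftrightarrow> two_sided_ideal I \<and> 1 \<notin> I \<and> (\<forall>x. x \<notin> I \<longrightarrow> (\<exists>n>0. x ^ n - 1 \<in> I)) \<and>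
    (\<exists>x y. x * y - y * x \<notin> I)"

definition some_ideal :: "'a::ring_1 set" where
  "some_ideal = (SOME I. two_sided_ideal I \<and> 1 \<notin> I \<and> (Ex (bad_ideal :: 'a set \<Rightarrow> bool) \<longrightarrow> bad_ideal I))"

lemma some_ideal:
  "two_sided_ideal (some_ideal :: 'a::ring_1 set)" "1 \<notin> (some_ideal :: 'a set)"
  "bad_ideal (I :: 'a set) \<Longrightarrow> bad_ideal (some_ideal :: 'a set)"
proof -
  have "\<exists>I :: 'a set. two_sided_ideal I \<and> 1 \<notin> I \<and> (Ex (bad_ideal :: 'a set \<Rightarrow> bool) \<longrightarrow> bad_ideal I)"
  proof (cases "Ex (bad_ideal :: 'a set \<Rightarrow> bool)")
    case True
    then show ?thesis by (auto simp: bad_ideal_def)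
  next
    case False
    then show ?thesis by (intro exI[of _ "{0}"]) (simp add: two_sided_ideal_def)
  qed
  from someI_ex[OF this] show "two_sided_ideal (some_ideal :: 'a set)" "1 \<notin> (some_ideal :: 'a set)"
    "bad_ideal (I :: 'a set) \<Longrightarrow> bad_ideal (some_ideal :: 'a set)"
    unfolding some_ideal_def by blast+
qed

interpretation some_ideal: ideal_congruence "some_ideal :: 'a::ring_1 set"
  by unfold_locales (rule some_ideal)

quotient_type (overloaded) 'a some_quotient = "'a::ring_1" / "\<lambda>x y. x - y \<in> (some_ideal :: 'a set)"
  by (rule equivpI)
    (auto simp: reflp_def symp_def transp_def simp flip: some_ideal.cong_def
      intro: some_ideal.cong_sym some_ideal.cong_trans)

instantiation some_quotient :: (ring_1) ring_1
begin

lift_definition zero_some_quotient :: "'a some_quotient" is 0 .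

lift_definition one_some_quotient :: "'a some_quotient" is 1 .

lift_definition plus_some_quotient :: "'a some_quotient \<Rightarrow> 'a some_quotient \<Rightarrow> 'a some_quotient" is plus
  unfolding some_ideal.cong_def[symmetric] by (rule some_ideal.cong_add)

lift_definition minus_some_quotient :: "'a some_quotient \<Rightarrow> 'a some_quotient \<Rightarrow> 'a some_quotient" is minus
  unfolding some_ideal.cong_def[symmetric] by (rule some_ideal.cong_diff)

lift_definition uminus_some_quotient :: "'a some_quotient \<Rightarrow> 'a some_quotient" is uminus
  using some_ideal.cong_diff[OF some_ideal.cong_refl[of 0]] by (simp add: some_ideal.cong_def)

lift_definition times_some_quotient :: "'a some_quotient \<Rightarrow> 'a some_quotient \<Rightarrow> 'a some_quotient" is times
  unfolding some_ideal.cong_def[symmetric] by (rule some_ideal.cong_mult)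

instance
  by standard
    (transfer, use some_ideal.zero_mem some_ideal(2) some_ideal.minus_mem in \<open>fastforce simp: algebra_simps\<close>)+

end

lemma abs_some_quotient_eq_iff:
  "abs_some_quotient x = abs_some_quotient y \<longleftrightarrow> x - y \<in> some_ideal"
  by (rule some_quotient.abs_eq_iff)

lemma abs_some_quotient_power: "abs_some_quotient x ^ n = abs_some_quotient (x ^ n)"
  by (induction n) (simp_all add: one_some_quotient.abs_eq times_some_quotient.abs_eq)

text \<open>If a bad ideal exists, \<open>some_ideal\<close> is one; its quotient then satisfies
  \<open>torsion_units\<close>, and the resulting commutativity contradicts the last clause of
  \<open>bad_ideal\<close>.\<close>

lemma not_bad_ideal: "\<not> bad_ideal (I :: 'a::ring_1 set)"
proof
  assume "bad_ideal I"
  then have bad: "bad_ideal (some_ideal :: 'a set)" by (rule some_ideal(3))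
  interpret torsion_units "TYPE('a some_quotient)"
  proof
    fix x :: "'a some_quotient" assume "x \<noteq> 0"
    have "\<exists>y. x = abs_some_quotient y" by (induction x rule: some_quotient.abs_induct) blast
    then obtain y where y: "x = abs_some_quotient y" ..
    then have "y \<notin> some_ideal"
      using \<open>x \<noteq> 0\<close> abs_some_quotient_eq_iff[of y 0] by (simp add: zero_some_quotient_def)
    then obtain n where "n > 0" "y ^ n - 1 \<in> some_ideal" using bad by (auto simp: bad_ideal_def)
    then show "\<exists>n>0. x ^ n = 1"
      by (auto simp: y abs_some_quotient_power one_some_quotient_def abs_some_quotient_eq_iff)
  qed
  have "x * y - y * x \<in> some_ideal" for x y :: 'a
    using commutative[of "abs_some_quotient x" "abs_some_quotient y"]
    by (simp add: times_some_quotient.abs_eq abs_some_quotient_eq_iff)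
  then show False using bad by (auto simp: bad_ideal_def)
qed

section \<open>Idempotents and the passage to a division ring\<close>

context ideal_congruence
begin

text \<open>Centrality of \<open>f\<close> modulo \<open>J\<close> lets a right factor
  \<open>u\<close> of \<open>s * f\<close> move to the left of \<open>f\<close>, so left multiples
  of \<open>f\<close> suffice.\<close>

lemma ideal_add_principal:
  assumes central: "\<And>s. s * f - f * s \<in> J"
  shows "two_sided_ideal {m + s * f | m s. m \<in> J}"
proof -
  let ?I = "{m + s * f | m s. m \<in> J}"
  have iff: "x \<in> ?I \<longleftrightarrow> (\<exists>s. x - s * f \<in> J)" for x
    by (auto, metis add_diff_cancel_right', metis add.commute diff_add_cancel)
  have "0 \<in> ?I" unfolding iff by (rule exI[of _ 0]) (simp add: zero_mem)
  moreover have "x + y \<in> ?I" if xy: "x \<in> ?I" "y \<in> ?I" for x y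
  proof -
    obtain s t where "x - s * f \<in> J" "y - t * f \<in> J" using xy unfolding iff by blast
    then show ?thesis unfolding iff
      using add_mem by (intro exI[of _ "s + t"]) (fastforce simp: algebra_simps)
  qed
  moreover have "- x \<in> ?I \<and> u * x \<in> ?I \<and> x * u \<in> ?I" if x: "x \<in> ?I" for x u
  proof -
    obtain s where s: "x - s * f \<in> J" using x unfolding iff by blast
    have "- x - (- s) * f \<in> J" using minus_mem[OF s] by simp
    moreover have "u * x - (u * s) * f \<in> J" using left_mem[OF s, of u] by (simp add: algebra_simps)
    moreover have "x * u - (s * u) * f \<in> J"
      using diff_mem[OF right_mem[OF s, of u] left_mem[OF central[of u], of s]]
      by (simp add: algebra_simps)
    ultimately show ?thesis unfolding iff by blast
  qed
  ultimately show ?thesis unfolding two_sided_ideal_def by blast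
qed

end

text \<open>From \<open>x ^ m = x ^ (m + d)\<close> take \<open>k = m * d\<close>, a multiple of the
  period that is at least \<open>m\<close>; this makes \<open>x ^ k\<close> idempotent. The
  \<open>m\<close>-th power of \<open>x ^ Suc k - x = (x ^ k - 1) * x\<close> contains the factor
  \<open>(x ^ k - 1) * x ^ m = 0\<close>.\<close>

lemma periodic_idempotent_power:
  fixes x :: "'a::ring_1"
  assumes "periodic_element x"
  shows "\<exists>k>0. x ^ k * x ^ k = x ^ k \<and> nilpotent_element (x ^ Suc k - x)"
proof -
  have "\<exists>m d. m > 0 \<and> d > 0 \<and> x ^ m = x ^ (m + d)"
  proof -
    obtain m n where mn: "m > 0" "n > 0" "m \<noteq> n" "x ^ m = x ^ n"
      using assms by (auto simp: periodic_element_def)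
    show ?thesis
    proof (cases "m < n")
      case True
      then show ?thesis using mn by (intro exI[of _ m] exI[of _ "n - m"]) simp
    next
      case False
      then show ?thesis using mn by (intro exI[of _ n] exI[of _ "m - n"]) simp
    qed
  qed
  then obtain m d where md: "m > 0" "d > 0" "x ^ m = x ^ (m + d)" by blast
  have shift: "x ^ (m + j * d) = x ^ m" for j
  proof (induction j)
    case (Suc j)
    have "x ^ (m + Suc j * d) = x ^ (m + d) * x ^ (j * d)" by (simp add: add.assoc flip: power_add)
    also have "\<dots> = x ^ (m + j * d)" by (simp only: md(3)[symmetric] power_add[of x m "j * d"])
    finally show ?case using Suc by simp
  qed simp
  define k where "k = m * d"
  have "k \<ge> m" "k > 0" using md(1,2) by (simp_all add: k_def)
  have "x ^ k * x ^ k = x ^ (k - m) * x ^ (m + m * d)"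
    using \<open>k \<ge> m\<close> by (simp add: k_def flip: power_add)
  also have "\<dots> = x ^ k" unfolding shift using \<open>k \<ge> m\<close> by (simp flip: power_add)
  finally have "x ^ k * x ^ k = x ^ k" .
  moreover have "(x ^ Suc k - x) ^ m = 0"
  proof -
    have eq: "x ^ Suc k - x = (x ^ k - 1) * x" by (simp add: left_diff_distrib power_commutes)
    have comm: "(x ^ k - 1) * x = x * (x ^ k - 1)"
      by (simp add: left_diff_distrib right_diff_distrib power_commutes)
    have "(x ^ k - 1) * x ^ m = 0"
      using shift[of m] by (simp add: left_diff_distrib k_def add.commute flip: power_add)
    moreover have "((x ^ k - 1) * x) ^ j = (x ^ k - 1) ^ j * x ^ j" for j
    proof (induction j)
      case (Suc j)
      have "((x ^ k - 1) * x) ^ Suc j = (x ^ k - 1) * (x * (x ^ k - 1) ^ j) * x ^ j"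
        by (simp add: Suc mult.assoc)
      also have "x * (x ^ k - 1) ^ j = (x ^ k - 1) ^ j * x"
        by (rule power_commuting_commutes[OF comm, symmetric])
      finally show ?case by (simp add: mult.assoc)
    qed simp
    moreover have "(x ^ k - 1) ^ m = (x ^ k - 1) ^ (m - 1) * (x ^ k - 1)"
      using md(1) by (simp flip: power_Suc2)
    ultimately have "(x ^ Suc k - x) ^ m = (x ^ k - 1) ^ (m - 1) * ((x ^ k - 1) * x ^ m)"
      by (simp only: eq mult.assoc)
    also have "\<dots> = 0" by (simp only: \<open>(x ^ k - 1) * x ^ m = 0\<close> mult_zero_right)
    finally show ?thesis .
  qed
  ultimately show ?thesis using \<open>k > 0\<close> md(1) unfolding nilpotent_element_def by blast
qed

text \<open>Both \<open>s * f - f * s * f\<close> and \<open>f * s - f * s * f\<close> have square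
  zero, and the commutator is their difference.\<close>

lemma idempotent_commutator_mem:
  fixes L :: "'a::ring_1 set"
  assumes L: "two_sided_ideal L" and nil: "\<And>x::'a. nilpotent_element x \<Longrightarrow> x \<in> L"
    and f: "f * f = f"
  shows "s * f - f * s \<in> L"
proof -
  interpret ideal_congruence L by unfold_locales (rule L)
  have ff: "f * (f * z) = f * z" for z using f by (simp flip: mult.assoc)
  have "(s * f - f * s * f) ^ 2 = 0" "(f * s - f * s * f) ^ 2 = 0"
    by (simp_all add: power2_eq_square algebra_simps ff f)
  then have "s * f - f * s * f \<in> L" "f * s - f * s * f \<in> L"
    by (auto intro!: nil exI[of _ 2] simp: nilpotent_element_def)
  from diff_mem[OF this] show ?thesis by simp
qed

lemma two_sided_ideal_Union_chain:
  fixes \<C> :: "'a::ring_1 set set"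
  assumes C: "\<C> \<noteq> {}" "subset.chain \<A> \<C>" and ideals: "\<And>I. I \<in> \<C> \<Longrightarrow> two_sided_ideal I"
  shows "two_sided_ideal (\<Union>\<C>)"
proof -
  have "x + y \<in> \<Union>\<C>" if xy: "x \<in> \<Union>\<C>" "y \<in> \<Union>\<C>" for x y
  proof -
    obtain I I' where I: "I \<in> \<C>" "x \<in> I" "I' \<in> \<C>" "y \<in> I'" using xy by blast
    then have "I \<subseteq> I' \<or> I' \<subseteq> I" using C(2) unfolding subset_chain_def by blast
    then obtain I0 where I0: "I0 \<in> \<C>" "x \<in> I0" "y \<in> I0" using I by blast
    then have "x + y \<in> I0" using ideals[OF I0(1)] by (simp add: two_sided_ideal_def)
    then show ?thesis using I0(1) by blast
  qed
  moreover have "0 \<in> \<Union>\<C>" using C(1) ideals by (auto simp: two_sided_ideal_def)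
  moreover have "- x \<in> \<Union>\<C> \<and> r * x \<in> \<Union>\<C> \<and> x * r \<in> \<Union>\<C>" if x: "x \<in> \<Union>\<C>" for x r
  proof -
    obtain I where I: "I \<in> \<C>" "x \<in> I" using x by blast
    then have "- x \<in> I \<and> r * x \<in> I \<and> x * r \<in> I"
      using ideals[OF I(1)] by (simp add: two_sided_ideal_def)
    then show ?thesis using I(1) by blast
  qed
  ultimately show ?thesis unfolding two_sided_ideal_def by blast
qed

text \<open>Division by an ideal \<open>M\<close> that contains \<open>L\<close> and is maximal with respect to avoiding
  the non-zero idempotent power \<open>e\<close> of a commutator gives a non-commutative division ring all of
  whose units have finite order.\<close>

theorem periodic_ring_commutator_mem:
  fixes L :: "'a::ring_1 set"
  assumes per: "periodic_ring TYPE('a)" and L: "two_sided_ideal L"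
    and nil: "\<And>x::'a. nilpotent_element x \<Longrightarrow> x \<in> L"
  shows "x * y - y * x \<in> L"
proof (rule ccontr)
  define c where "c = x * y - y * x"
  assume "x * y - y * x \<notin> L"
  then have c: "c \<notin> L" by (simp add: c_def)
  interpret L: ideal_congruence L by unfold_locales (rule L)
  have "periodic_element c" using per by (simp add: periodic_ring_def)
  then obtain k0 where k0: "k0 > 0" "c ^ k0 * c ^ k0 = c ^ k0" "c ^ Suc k0 - c \<in> L"
    using periodic_idempotent_power nil by metis
  define e where "e = c ^ k0"
  have ee: "e * e = e" using k0 by (simp add: e_def)
  \<comment> \<open>Modulo \<open>L\<close>, \<open>c\<close> is congruent to its multiple
    \<open>c * e\<close>.\<close>
  have "e \<notin> L"
  proof
    assume "e \<in> L"
    then have "c ^ Suc k0 \<in> L" by (simp add: e_def L.left_mem)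
    then have "c ^ Suc k0 - (c ^ Suc k0 - c) \<in> L" using k0(3) L.diff_mem by blast
    then show False using c by simp
  qed
  let ?\<A> = "{I. two_sided_ideal I \<and> L \<subseteq> I \<and> e \<notin> I}"
  have "\<exists>M\<in>?\<A>. \<forall>I\<in>?\<A>. M \<subseteq> I \<longrightarrow> I = M"
  proof (rule subset_Zorn_nonempty)
    show "?\<A> \<noteq> {}" using L \<open>e \<notin> L\<close> by blast
    fix \<C> assume C: "\<C> \<noteq> {}" "subset.chain ?\<A> \<C>"
    then have ideals: "I \<in> ?\<A>" if "I \<in> \<C>" for I using that by (auto simp: subset.chain_def)
    have "two_sided_ideal (\<Union>\<C>)" using C ideals by (intro two_sided_ideal_Union_chain[of _ ?\<A>]) auto
    then show "\<Union>\<C> \<in> ?\<A>" using C(1) ideals by blast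
  qed
  then obtain M where M: "two_sided_ideal M" "L \<subseteq> M" "e \<notin> M"
    and max: "\<And>I. two_sided_ideal I \<Longrightarrow> e \<notin> I \<Longrightarrow> M \<subseteq> I \<Longrightarrow> I = M" by (auto; blast)
  interpret M: ideal_congruence M by unfold_locales (rule M)
  \<comment> \<open>By maximality, \<open>M\<close> together with the multiples of \<open>f\<close>
    generates an ideal containing \<open>e\<close>, and \<open>1 - f\<close> annihilates these
    multiples.\<close>
  have annihilate: "e * (1 - f) \<in> M" if f: "f * f = f" "f \<notin> M" for f
  proof -
    let ?I = "{m + s * f | m s. m \<in> M}"
    have "two_sided_ideal ?I"
      using idempotent_commutator_mem[OF L nil f(1)] M(2) by (intro M.ideal_add_principal) blast
    moreover have "M \<subseteq> ?I" by (rule subsetI, rule CollectI, rule exI, rule exI[of _ 0]) simp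
    moreover have "?I \<noteq> M"
    proof -
      have "f \<in> ?I" by (rule CollectI, rule exI[of _ 0], rule exI[of _ 1]) (simp add: M.zero_mem)
      then show ?thesis using f(2) by metis
    qed
    ultimately have "e \<in> ?I" using max by blast
    then obtain m s where m: "e = m + s * f" "m \<in> M" by blast
    have "s * f * (1 - f) = 0" using f(1) by (simp add: right_diff_distrib mult.assoc)
    then have "e * (1 - f) = m * (1 - f)" by (simp add: m(1) distrib_right)
    then show ?thesis using m(2) M.right_mem by simp
  qed
  \<comment> \<open>Otherwise annihilation for the idempotent \<open>1 - e\<close> would put
    \<open>e\<close> into \<open>M\<close>; so \<open>e\<close> acts as the identity modulo
    \<open>M\<close>.\<close>
  have "1 - e \<in> M"
  proof (rule ccontr)
    assume "1 - e \<notin> M"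
    then have "e * (1 - (1 - e)) \<in> M" by (intro annihilate) (simp_all add: algebra_simps ee)
    then show False using M(3) ee by simp
  qed
  have "\<exists>n>0. z ^ n - 1 \<in> M" if z: "z \<notin> M" for z
  proof -
    have "periodic_element z" using per by (simp add: periodic_ring_def)
    then obtain k where k: "k > 0" "z ^ k * z ^ k = z ^ k" "z ^ Suc k - z \<in> L"
      using periodic_idempotent_power nil by metis
    have "z ^ k \<notin> M"
    proof
      assume "z ^ k \<in> M"
      then have "z ^ Suc k \<in> M" unfolding power_Suc by (rule M.left_mem)
      moreover have "z ^ Suc k - z \<in> M" using k(3) M(2) by blast
      ultimately have "z ^ Suc k - (z ^ Suc k - z) \<in> M" by (rule M.diff_mem)
      then show False using z by simp
    qed
    then have "e * (1 - z ^ k) \<in> M" by (rule annihilate[OF k(2)])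
    moreover have "(1 - e) * (1 - z ^ k) \<in> M" using \<open>1 - e \<in> M\<close> by (rule M.right_mem)
    ultimately have "- (e * (1 - z ^ k) + (1 - e) * (1 - z ^ k)) \<in> M"
      by (intro M.minus_mem M.add_mem)
    then show ?thesis using k(1) by (auto simp: algebra_simps)
  qed
  moreover have "1 \<notin> M" using M.left_mem[of 1 e] M(3) by auto
  \<comment> \<open>A power of \<open>c\<close>, namely \<open>e\<close>, lies outside
    \<open>M\<close>, so the commutator survives in the quotient.\<close>
  moreover have "c \<notin> M"
    using M.right_mem[of c "c ^ (k0 - 1)"] M(3) k0(1) by (auto simp: e_def simp flip: power_Suc)
  ultimately have "bad_ideal M" using M(1) by (auto simp: bad_ideal_def c_def)
  then show False using not_bad_ideal by blast
qed

section \<open>Nilpotent groups\<close>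

lemma subgroup_of_Inter: "(\<And>H. H \<in> \<H> \<Longrightarrow> subgroup_of H) \<Longrightarrow> subgroup_of (\<Inter>\<H>)"
  unfolding subgroup_of_def by blast

lemma subgroup_generated_subgroup: "subgroup_of (generated_subgroup S)"
  unfolding generated_subgroup_def hull_def by (rule subgroup_of_Inter) simp

lemma generated_subgroup_superset: "S \<subseteq> generated_subgroup S"
  unfolding generated_subgroup_def by (rule hull_subset)

lemma generated_subgroup_minimal: "S \<subseteq> H \<Longrightarrow> subgroup_of H \<Longrightarrow> generated_subgroup S \<subseteq> H"
  unfolding generated_subgroup_def by (rule hull_minimal)

primrec multiple :: "nat \<Rightarrow> 'g::group_add \<Rightarrow> 'g" where
  "multiple 0 x = 0"
| "multiple (Suc n) x = x + multiple n x"

lemma multiple_add: "multiple (m + n) x = multiple m x + multiple n x"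
  by (induction m) (simp_all add: add.assoc)

lemma multiple_Suc_right: "multiple (Suc n) x = multiple n x + x"
  using multiple_add[of n 1 x] by simp

lemma multiple_mult: "multiple (m * n) x = multiple m (multiple n x)"
  by (induction m) (simp_all add: multiple_add)

lemma multiple_uminus: "multiple n (- x) = - multiple n x"
proof (induction n)
  case (Suc n)
  have "multiple (Suc n) (- x) = - multiple n x + - x"
    by (simp only: multiple_Suc_right Suc)
  also have "\<dots> = - multiple (Suc n) x" by (simp add: minus_add)
  finally show ?case .
qed simp

locale normal_subgroup =
  fixes K :: "'g::group_add set"
  assumes subgroup: "subgroup_of K" and normal: "x \<in> K \<Longrightarrow> g + x - g \<in> K"
begin

lemma zero_mem: "0 \<in> K" and add_mem: "x \<in> K \<Longrightarrow> y \<in> K \<Longrightarrow> x + y \<in> K"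
  and minus_mem: "x \<in> K \<Longrightarrow> - x \<in> K"
  using subgroup unfolding subgroup_of_def by blast+

lemma multiple_mem: "x \<in> K \<Longrightarrow> multiple n x \<in> K"
  by (induction n) (auto intro: zero_mem add_mem)

definition cong :: "'g \<Rightarrow> 'g \<Rightarrow> bool" (infix "\<approx>" 50) where
  "x \<approx> y \<longleftrightarrow> x - y \<in> K"

lemma cong_0_iff: "x \<approx> 0 \<longleftrightarrow> x \<in> K"
  by (simp add: cong_def)

lemma cong_refl [simp, intro]: "x \<approx> x"
  by (simp add: cong_def zero_mem)

lemma cong_sym: "x \<approx> y \<Longrightarrow> y \<approx> x"
  using minus_mem[of "x - y"] by (simp add: cong_def)

lemma cong_trans [trans]: "x \<approx> y \<Longrightarrow> y \<approx> z \<Longrightarrow> x \<approx> z"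
  using add_mem[of "x - y" "y - z"] by (simp add: cong_def add_diff_eq)

lemma cong_add: "x \<approx> y \<Longrightarrow> x' \<approx> y' \<Longrightarrow> x + x' \<approx> y + y'"
proof -
  assume "x \<approx> y" "x' \<approx> y'"
  then have "(x - y) + (y + (x' - y') - y) \<in> K" using normal add_mem by (simp add: cong_def)
  also have "(x - y) + (y + (x' - y') - y) = x + x' - (y + y')"
    by (simp add: add_diff_eq diff_add_eq_diff_diff_swap add.assoc[symmetric])
  finally show ?thesis by (simp add: cong_def)
qed

lemma cong_mem_iff: "x \<approx> y \<Longrightarrow> x \<in> K \<longleftrightarrow> y \<in> K"
  using cong_trans cong_sym cong_0_iff by blast

end

text \<open>The image of \<open>A\<close> in the group modulo \<open>K\<close> is a central
  subgroup.\<close>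

locale central_section = normal_subgroup K for K :: "'g::group_add set" +
  fixes A :: "'g set"
  assumes A_subgroup: "subgroup_of A"
    and central: "x \<in> A \<Longrightarrow> group_commutator x g \<in> K"
begin

lemma A_zero: "0 \<in> A" and A_add: "x \<in> A \<Longrightarrow> y \<in> A \<Longrightarrow> x + y \<in> A"
  and A_minus: "x \<in> A \<Longrightarrow> - x \<in> A"
  using A_subgroup unfolding subgroup_of_def by blast+

lemma A_multiple: "x \<in> A \<Longrightarrow> multiple n x \<in> A"
  by (induction n) (auto intro: A_zero A_add)

lemma cong_commute: "x \<in> A \<Longrightarrow> x + g \<approx> g + x"
  using central[of x g]
  by (simp add: cong_def group_commutator_def diff_add_eq_diff_diff_swap add.assoc)

lemma multiple_add_cong:
  assumes "x \<in> A" shows "multiple n (x + y) \<approx> multiple n x + multiple n y"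
proof (induction n)
  case (Suc n)
  have "multiple (Suc n) (x + y) \<approx> x + y + (multiple n x + multiple n y)"
    using cong_add[OF cong_refl Suc] by simp
  also have "\<dots> = x + (y + multiple n x) + multiple n y" by (simp add: add.assoc)
  also have "\<dots> \<approx> x + (multiple n x + y) + multiple n y"
    by (intro cong_add cong_sym[OF cong_commute] A_multiple assms cong_refl)
  also have "\<dots> = multiple (Suc n) x + multiple (Suc n) y" by (simp add: add.assoc)
  finally show ?case .
qed simp

text \<open>Centrality makes multiples additive modulo \<open>K\<close>, so exponents
  \<open>n\<close> and \<open>m\<close> of two elements combine to \<open>n * m\<close> for their
  sum.\<close>

lemma subgroup_torsion: "subgroup_of {x \<in> A. \<exists>n>0. multiple n x \<in> K}"
  unfolding subgroup_of_def
proof (intro conjI ballI)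
  show "0 \<in> {x \<in> A. \<exists>n>0. multiple n x \<in> K}"
    using A_zero zero_mem by (auto intro: exI[of _ 1])
  fix x assume "x \<in> {x \<in> A. \<exists>n>0. multiple n x \<in> K}"
  then obtain n where n: "x \<in> A" "n > 0" "multiple n x \<in> K" by blast
  then show "- x \<in> {x \<in> A. \<exists>n>0. multiple n x \<in> K}"
    using A_minus minus_mem by (auto simp: multiple_uminus)
  fix y assume "y \<in> {x \<in> A. \<exists>n>0. multiple n x \<in> K}"
  then obtain m where m: "y \<in> A" "m > 0" "multiple m y \<in> K" by blast
  have "multiple (n * m) (x + y) \<approx> multiple (m * n) x + multiple (n * m) y"
    using multiple_add_cong[OF n(1)] by (simp add: mult.commute)
  moreover have "multiple (m * n) x + multiple (n * m) y \<in> K"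
    by (simp add: multiple_mult add_mem multiple_mem n m)
  ultimately have "multiple (n * m) (x + y) \<in> K" using cong_mem_iff by blast
  then show "x + y \<in> {x \<in> A. \<exists>n>0. multiple n x \<in> K}"
    using n m A_add by (auto intro!: exI[of _ "n * m"])
qed

text \<open>Sums of bounded multiples of the elements of \<open>Z\<close> serve as \<open>W\<close>,
  adjoined one \<open>z\<close> at a time. An exponent of \<open>z\<close> modulo \<open>K\<close>
  bounds its multiples, and centrality allows reordering.\<close>

lemma finite_transversal_section:
  assumes "finite Z" "Z \<subseteq> A" and torsion: "\<And>x. x \<in> A \<Longrightarrow> \<exists>n>0. multiple n x \<in> K"
  shows "\<exists>W. finite W \<and> W \<subseteq> A \<and> 0 \<in> W \<and> (\<forall>w\<in>W. \<forall>z\<in>Z. \<exists>w'\<in>W. w + z \<approx> w')"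
  using assms(1,2)
proof (induction Z)
  case empty
  then show ?case using A_zero by (intro exI[of _ "{0}"]) auto
next
  case (insert z Z)
  from insert.IH insert.prems obtain W where W: "finite W" "W \<subseteq> A" "0 \<in> W"
    "\<And>w z. w \<in> W \<Longrightarrow> z \<in> Z \<Longrightarrow> \<exists>w'\<in>W. w + z \<approx> w'"
    by (meson insert_subset)
  obtain n where n: "n > 0" "multiple n z \<in> K" using torsion insert.prems by auto
  define V where "V = (\<lambda>(w, e). w + multiple e z) ` (W \<times> {..<n})"
  have V_I: "w + multiple e z \<in> V" if "w \<in> W" "e < n" for w e
    using that by (auto simp: V_def)
  have "finite V" using W by (simp add: V_def)
  moreover have "V \<subseteq> A" using W insert.prems by (auto simp: V_def intro!: A_add A_multiple)
  moreover have "0 \<in> V" using V_I[of 0 0] W n by simp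
  moreover have "\<exists>v'\<in>V. v + y \<approx> v'" if v: "v \<in> V" "y \<in> insert z Z" for v y
  proof -
    obtain w e where w: "w \<in> W" "e < n" "v = w + multiple e z" using v by (auto simp: V_def)
    show ?thesis
    proof (cases "y = z")
      case True
      have eq: "v + y = w + multiple (Suc e) z"
        unfolding True w multiple_Suc_right by (simp add: add.assoc)
      show ?thesis
      proof (cases "Suc e < n")
        case True
        then show ?thesis using V_I[OF w(1) True] eq by auto
      next
        case False
        then have "Suc e = n" using w by simp
        then have "v + y \<approx> w + 0" unfolding eq using n by (intro cong_add) (auto simp: cong_0_iff)
        then show ?thesis using V_I[OF w(1) n(1)] by auto
      qed
    next
      case False
      then obtain w' where w': "w' \<in> W" "w + y \<approx> w'" using W(4) v w by blast
      have "v + y = w + (multiple e z + y)" by (simp add: w add.assoc)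
      also have "\<dots> \<approx> w + (y + multiple e z)"
        using insert.prems by (intro cong_add cong_commute A_multiple) auto
      also have "\<dots> = (w + y) + multiple e z" by (simp add: add.assoc)
      also have "\<dots> \<approx> w' + multiple e z" using w' by (intro cong_add) auto
      finally show ?thesis using V_I[OF w'(1) w(2)] by blast
    qed
  qed
  ultimately show ?case by (intro exI[of _ V] conjI ballI)
qed

text \<open>Schreier's argument: \<open>t + s\<close> and its representative in \<open>T\<close> differ by one of finitely many elements of
  \<open>A\<close>, and these generate a finite group modulo \<open>K\<close> because \<open>A\<close> is central and torsion modulo \<open>K\<close>.\<close>

lemma finite_transversal_step:
  assumes S: "finite S" and T: "finite T" "0 \<in> T" "\<And>t s. t \<in> T \<Longrightarrow> s \<in> S \<Longrightarrow> \<exists>t'\<in>T. - t' + (t + s) \<in> A"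
    and torsion: "\<And>x. x \<in> A \<Longrightarrow> \<exists>n>0. multiple n x \<in> K"
  shows "\<exists>T'. finite T' \<and> 0 \<in> T' \<and> (\<forall>t\<in>T'. \<forall>s\<in>S. \<exists>t'\<in>T'. - t' + (t + s) \<in> K)"
proof -
  obtain q where q: "\<And>t s. t \<in> T \<Longrightarrow> s \<in> S \<Longrightarrow> q t s \<in> T \<and> - q t s + (t + s) \<in> A"
    using T(3) by metis
  define Z where "Z = (\<lambda>(t, s). - q t s + (t + s)) ` (T \<times> S)"
  have "finite Z" "Z \<subseteq> A" using S T q by (auto simp: Z_def)
  from finite_transversal_section[OF this torsion] obtain W where
    "finite W \<and> W \<subseteq> A \<and> 0 \<in> W \<and> (\<forall>w\<in>W. \<forall>z\<in>Z. \<exists>w'\<in>W. w + z \<approx> w')" ..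
  then have W: "finite W" "W \<subseteq> A" "0 \<in> W"
    "\<And>w z. w \<in> W \<Longrightarrow> z \<in> Z \<Longrightarrow> \<exists>w'\<in>W. w + z \<approx> w'" by simp_all
  define T' where "T' = (\<lambda>(t, w). t + w) ` (T \<times> W)"
  have "\<exists>t'\<in>T'. - t' + (u + s) \<in> K" if u: "u \<in> T'" "s \<in> S" for u s
  proof -
    obtain t w where t: "t \<in> T" "w \<in> W" "u = t + w" using u by (auto simp: T'_def)
    define z where "z = - q t s + (t + s)"
    have ts: "t + s = q t s + z" by (simp add: z_def add.assoc[symmetric])
    have "z \<in> Z" using t u by (auto simp: Z_def z_def)
    then obtain w' where w': "w' \<in> W" "w + z \<approx> w'" using W t by blast
    have "u + s = t + (w + s)" by (simp add: t add.assoc)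
    also have "\<dots> \<approx> t + (s + w)" using W t by (intro cong_add cong_commute) auto
    also have "\<dots> = q t s + (z + w)" by (simp only: add.assoc[symmetric] ts)
    also have "\<dots> \<approx> q t s + (w + z)" using W t by (intro cong_add cong_sym[OF cong_commute]) auto
    also have "\<dots> \<approx> q t s + w'" using w' by (intro cong_add) auto
    \<comment> \<open>Conjugation turns the difference taken on the right into the one on the left
      that is required of \<open>T'\<close>.\<close>
    finally have "- (q t s + w') + (u + s - (q t s + w')) - - (q t s + w') \<in> K"
      unfolding cong_def by (rule normal)
    then have "- (q t s + w') + (u + s) \<in> K" by (simp add: add.assoc)
    moreover have "q t s + w' \<in> T'" using q t u w' by (auto simp: T'_def)
    ultimately show ?thesis by blast
  qed
  moreover have "finite T'" "0 \<in> T'" using T W by (auto simp: T'_def intro!: image_eqI[of _ _ "(0, 0)"])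
  ultimately show ?thesis by (intro exI[of _ T'] conjI ballI)
qed

end

section \<open>Torsion along the lower central series\<close>

lemma normal_subgroup_generated:
  assumes S: "\<And>x g. x \<in> S \<Longrightarrow> g + x - g \<in> S"
  shows "normal_subgroup (generated_subgroup S)"
proof
  show sub: "subgroup_of (generated_subgroup S)" by (rule subgroup_generated_subgroup)
  let ?H = "{h. \<forall>g. g + h - g \<in> generated_subgroup S}"
  have "subgroup_of ?H"
    unfolding subgroup_of_def
  proof (intro conjI ballI)
    show "0 \<in> ?H" using sub by (simp add: subgroup_of_def)
    fix x assume x: "x \<in> ?H"
    have eq: "g + - x - g = - (g + x - g)" for g
      by (simp add: diff_conv_add_uminus minus_add add.assoc del: add_uminus_conv_diff)
    then show "- x \<in> ?H" using x sub unfolding mem_Collect_eq subgroup_of_def by (intro allI) (subst eq, blast)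
    fix y assume y: "y \<in> ?H"
    have "g + (x + y) - g = (g + x - g) + (g + y - g)" for g
      by (simp add: diff_conv_add_uminus add.assoc del: add_uminus_conv_diff)
    then show "x + y \<in> ?H" using x y sub by (simp add: subgroup_of_def)
  qed
  moreover have "S \<subseteq> ?H" using S generated_subgroup_superset by blast
  ultimately have "generated_subgroup S \<subseteq> ?H" by (rule generated_subgroup_minimal[rotated])
  then show "g + x - g \<in> generated_subgroup S" if "x \<in> generated_subgroup S" for x g
    using that by blast
qed

lemma normal_subgroup_lower_central_series:
  "normal_subgroup (lower_central_series n :: 'g::group_add set)"
proof (induction n)
  case 0
  then show ?case by unfold_locales (simp_all add: subgroup_of_def)
next
  case (Suc n)
  have eq: "g + group_commutator x y - g = group_commutator (g + x - g) (g + y - g)" for g x y :: 'g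
    by (simp add: group_commutator_def diff_conv_add_uminus minus_add add.assoc del: add_uminus_conv_diff)
  show ?case unfolding lower_central_series.simps
    by (rule normal_subgroup_generated) (use eq normal_subgroup.normal[OF Suc] in blast)
qed

lemma central_section_lower_central_series:
  "central_section (lower_central_series (Suc n)) (lower_central_series n :: 'g::group_add set)"
proof -
  interpret normal_subgroup "lower_central_series (Suc n) :: 'g set"
    by (rule normal_subgroup_lower_central_series)
  show ?thesis
    by unfold_locales
      (use normal_subgroup.subgroup[OF normal_subgroup_lower_central_series] in
        \<open>auto intro!: subsetD[OF generated_subgroup_superset]\<close>)
qed

text \<open>Modulo term \<open>Suc (Suc i)\<close>, commutators with first argument in term
  \<open>i\<close> are compatible with multiples of it. So an exponent of \<open>u\<close> modulo
  term \<open>Suc i\<close> also kills \<open>group_commutator u y\<close>; these commutators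
  generate term \<open>Suc i\<close>, where the torsion elements form a subgroup.\<close>

lemma lower_central_series_torsion:
  assumes "\<And>x::'g::group_add. \<exists>n>0. multiple n x \<in> lower_central_series 1"
    and "x \<in> (lower_central_series i :: 'g set)"
  shows "\<exists>n>0. multiple n x \<in> lower_central_series (Suc i)"
  using assms(2)
proof (induction i arbitrary: x)
  case 0
  then show ?case using assms(1) by simp
next
  case (Suc i)
  interpret lo: central_section "lower_central_series (Suc i) :: 'g set" "lower_central_series i"
    by (rule central_section_lower_central_series)
  interpret central_section "lower_central_series (Suc (Suc i)) :: 'g set" "lower_central_series (Suc i)"
    by (rule central_section_lower_central_series)
  let ?T = "{x \<in> lower_central_series (Suc i). \<exists>n>0. multiple n x \<in> (lower_central_series (Suc (Suc i)) :: 'g set)}"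
  have "group_commutator u y \<in> ?T" if u: "u \<in> lower_central_series i" for u y :: 'g
  proof -
    have comm: "group_commutator v y \<in> lower_central_series (Suc i)"
      if "v \<in> lower_central_series i" for v
      using lo.central[OF that] .
    have "cong (group_commutator (multiple m u) y) (multiple m (group_commutator u y))" for m
    proof (induction m)
      case 0
      have "group_commutator (multiple 0 u) y = multiple 0 (group_commutator u y)"
        by (simp add: group_commutator_def)
      then show ?case by (simp only: cong_refl)
    next
      case (Suc m)
      \<comment> \<open>The first summand is a conjugate by \<open>u\<close>, the leading
        \<open>u\<close> being paired with the later \<open>- u\<close>; centrality removes this
        conjugation.\<close>
      have "group_commutator (multiple (Suc m) u) y =
          u + group_commutator (multiple m u) y + (- u + group_commutator u y)"
        by (simp add: group_commutator_def minus_add add.assoc diff_conv_add_uminus del: add_uminus_conv_diff)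
      also have "cong \<dots> (group_commutator (multiple m u) y + u + (- u + group_commutator u y))"
        by (intro cong_add cong_refl cong_sym[OF cong_commute] comm lo.A_multiple u)
      also have "\<dots> = group_commutator (multiple m u) y + group_commutator u y"
        by (simp add: add.assoc)
      also have "cong \<dots> (multiple m (group_commutator u y) + group_commutator u y)"
        by (intro cong_add Suc cong_refl)
      finally show ?case by (simp only: multiple_Suc_right)
    qed
    moreover obtain m where "m > 0" "multiple m u \<in> lower_central_series (Suc i)"
      using Suc.IH[OF u] by blast
    ultimately have "multiple m (group_commutator u y) \<in> lower_central_series (Suc (Suc i))"
      using central cong_mem_iff by blast
    then show ?thesis using \<open>m > 0\<close> comm u by blast
  qed
  then have "lower_central_series (Suc i) \<subseteq> ?T"
    unfolding lower_central_series.simps(2)[of i]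
    by (intro generated_subgroup_minimal) (use subgroup_torsion in auto)
  then show ?case using Suc.prems by blast
qed

text \<open>Descending the series, a finite set \<open>T\<close> containing 0 is refined until it is
  closed under adding \<open>S\<close> exactly. It then contains all sums of elements of
  \<open>S\<close>, hence the generated subgroup.\<close>

theorem nilpotent_group_locally_finite:
  assumes nil: "nilpotent_group TYPE('g::group_add)"
    and torsion: "\<And>x::'g. \<exists>n>0. multiple n x \<in> lower_central_series 1"
  shows "locally_finite_group TYPE('g)"
  unfolding locally_finite_group_def
proof (intro allI impI)
  fix S0 :: "'g set" assume "finite S0"
  define S where "S = S0 \<union> uminus ` S0"
  have S: "finite S" using \<open>finite S0\<close> by (simp add: S_def)
  have S_minus: "- s \<in> S" if "s \<in> S" for s using that by (auto simp: S_def)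
  have "\<exists>T. finite T \<and> 0 \<in> T \<and> (\<forall>t\<in>T. \<forall>s\<in>S. \<exists>t'\<in>T. - t' + (t + s) \<in> lower_central_series i)" for i
  proof (induction i)
    case 0
    then show ?case by (intro exI[of _ "{0}"]) simp
  next
    case (Suc i)
    interpret central_section "lower_central_series (Suc i) :: 'g set" "lower_central_series i"
      by (rule central_section_lower_central_series)
    from Suc obtain T where T: "finite T" "0 \<in> T"
      "\<And>t s. t \<in> T \<Longrightarrow> s \<in> S \<Longrightarrow> \<exists>t'\<in>T. - t' + (t + s) \<in> lower_central_series i" by blast
    show ?case
      by (rule finite_transversal_step[OF S T]) (assumption | rule lower_central_series_torsion[OF torsion])+
  qed
  moreover obtain n where "lower_central_series n = {0::'g}" using nil by (auto simp: nilpotent_group_def)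
  ultimately obtain T where T: "finite T" "0 \<in> T" "\<And>t s. t \<in> T \<Longrightarrow> s \<in> S \<Longrightarrow> \<exists>t'\<in>T. - t' + (t + s) = 0"
    by (metis singletonD)
  have T_add: "t + s \<in> T" if ts: "t \<in> T" "s \<in> S" for t s
  proof -
    obtain t' where t': "t' \<in> T" "- t' + (t + s) = 0" using T(3)[OF ts] by blast
    then show ?thesis using neg_eq_iff_add_eq_0[of "- t'" "t + s"] by simp
  qed
  let ?H = "{sum_list xs | xs. set xs \<subseteq> S}"
  have "subgroup_of ?H"
    unfolding subgroup_of_def
  proof (intro conjI ballI)
    show "0 \<in> ?H" by (auto intro!: exI[of _ "[]"])
    fix x assume "x \<in> ?H"
    then obtain xs where xs: "x = sum_list xs" "set xs \<subseteq> S" by blast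
    have "- sum_list xs = sum_list (rev (map uminus xs))" for xs :: "'g list"
      by (induction xs) (simp_all add: minus_add)
    moreover have "set (rev (map uminus xs)) \<subseteq> S" using xs S_minus by auto
    ultimately show "- x \<in> ?H" using xs by blast
    fix y assume "y \<in> ?H"
    then obtain ys where ys: "y = sum_list ys" "set ys \<subseteq> S" by blast
    show "x + y \<in> ?H" using xs ys by (auto intro!: exI[of _ "xs @ ys"])
  qed
  moreover have "S0 \<subseteq> ?H"
    by (auto simp: S_def intro!: exI[of _ "[_]"])
  ultimately have "generated_subgroup S0 \<subseteq> ?H" by (rule generated_subgroup_minimal[rotated])
  also have "?H \<subseteq> T"
  proof clarify
    fix xs assume "set xs \<subseteq> S"
    then show "sum_list xs \<in> T"
      by (induction xs rule: rev_induct) (auto intro: T T_add)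
  qed
  finally show "finite (generated_subgroup S0)" using T(1) by (rule finite_subset)
qed

section \<open>Group rings\<close>

lemma poly_mapping_sum_single:
  fixes f :: "'a \<Rightarrow>\<^sub>0 'b::comm_monoid_add"
  shows "f = (\<Sum>k\<in>Poly_Mapping.keys f. Poly_Mapping.single k (Poly_Mapping.lookup f k))"
proof (rule poly_mapping_eqI)
  fix x
  show "Poly_Mapping.lookup f x =
      Poly_Mapping.lookup (\<Sum>k\<in>Poly_Mapping.keys f. Poly_Mapping.single k (Poly_Mapping.lookup f k)) x"
    by (simp add: lookup_sum lookup_single when_def in_keys_iff)
qed

lemma poly_mapping_additive_induct [case_names zero single add]:
  fixes f :: "'a \<Rightarrow>\<^sub>0 'b::comm_monoid_add"
  assumes "P 0" "\<And>k v. P (Poly_Mapping.single k v)" "\<And>f g. P f \<Longrightarrow> P g \<Longrightarrow> P (f + g)"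
  shows "P f"
proof -
  have "P (\<Sum>k\<in>A. Poly_Mapping.single k (Poly_Mapping.lookup f k))" if "finite A" for A
    using that by (induction A) (auto intro: assms)
  then show ?thesis using poly_mapping_sum_single[of f] by (metis finite_keys)
qed

lemma lookup_mult_keys:
  fixes f g :: "'g::monoid_add \<Rightarrow>\<^sub>0 'r::semiring_0"
  shows "Poly_Mapping.lookup (f * g) k = (\<Sum>a\<in>Poly_Mapping.keys f. \<Sum>b\<in>Poly_Mapping.keys g.
    Poly_Mapping.lookup f a * Poly_Mapping.lookup g b when a + b = k)"
proof -
  have "f * g = (\<Sum>a\<in>Poly_Mapping.keys f. \<Sum>b\<in>Poly_Mapping.keys g.
      Poly_Mapping.single (a + b) (Poly_Mapping.lookup f a * Poly_Mapping.lookup g b))"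
    by (subst poly_mapping_sum_single[of f], subst poly_mapping_sum_single[of g])
      (simp only: sum_product mult_single)
  then show ?thesis by (simp add: lookup_sum lookup_single)
qed

lemma single_power:
  "Poly_Mapping.single (g :: 'g::group_add) (1::'r::ring_1) ^ n = Poly_Mapping.single (multiple n g) 1"
  by (induction n) (simp_all add: mult_single)

lemma of_nat_group_ring_eq_0:
  assumes "of_nat N = (0::'r::ring_1)"
  shows "of_nat N = (0 :: 'g::group_add \<Rightarrow>\<^sub>0 'r)"
  using single_of_nat[of N, where ?'a = 'g and ?'b = 'r] assms by simp

text \<open>The coefficients of \<open>f ^ n\<close> are sums of products of \<open>n\<close>
  coefficients of \<open>f\<close>, and all these products vanish for \<open>n = N\<close>.\<close>

lemma nilpotent_group_ring_element:
  fixes f :: "'g::group_add \<Rightarrow>\<^sub>0 'r::ring_1"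
  assumes L: "locally_nilpotent L" and f: "\<And>k. Poly_Mapping.lookup f k \<in> L"
  shows "nilpotent_element f"
proof -
  define F where "F = Poly_Mapping.lookup f ` Poly_Mapping.keys f"
  have "finite F" "F \<subseteq> L" using f by (auto simp: F_def)
  then obtain N where N: "\<And>xs. set xs \<subseteq> F \<Longrightarrow> length xs = N \<Longrightarrow> prod_list xs = 0"
    using L unfolding locally_nilpotent_def by meson
  have "Poly_Mapping.lookup (f ^ n) k \<in> additive_closure {prod_list xs | xs. set xs \<subseteq> F \<and> length xs = n}" for n k
  proof (induction n arbitrary: k)
    case 0
    have "(1::'r) \<in> {prod_list xs | xs. set xs \<subseteq> F \<and> length xs = 0}" by auto
    then show ?case
      by (auto simp: lookup_one when_def intro: additive_closure.zero additive_closure_base)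
  next
    case (Suc n)
    let ?A = "\<lambda>n. additive_closure {prod_list xs | xs. set xs \<subseteq> F \<and> length xs = n}"
    have prods: "s * t \<in> ?A (Suc n)"
      if s: "s \<in> F" and t: "t \<in> {prod_list xs | xs. set xs \<subseteq> F \<and> length xs = n}" for s t
    proof -
      obtain xs where "t = prod_list xs" "set xs \<subseteq> F" "length xs = n" using t by blast
      then have "s * t = prod_list (s # xs) \<and> set (s # xs) \<subseteq> F \<and> length (s # xs) = Suc n"
        using s by simp
      then show ?thesis by (intro additive_closure_base) blast
    qed
    show ?case unfolding power_Suc lookup_mult_keys
    proof (intro additive_closure_sum)
      fix a b assume "a \<in> Poly_Mapping.keys f"
      then have "Poly_Mapping.lookup f a \<in> additive_closure F"
        by (intro additive_closure_base) (simp add: F_def)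
      then have "Poly_Mapping.lookup f a * Poly_Mapping.lookup (f ^ n) b \<in> ?A (Suc n)"
        by (rule additive_closure_mult[OF _ _ Suc.IH, rotated]) (erule (1) prods)
      then show "(Poly_Mapping.lookup f a * Poly_Mapping.lookup (f ^ n) b when a + b = k) \<in> ?A (Suc n)"
        by (simp add: when_def additive_closure.zero)
    qed
  qed
  moreover have "additive_closure {prod_list xs | xs. set xs \<subseteq> F \<and> length xs = N} \<subseteq> {0}"
  proof
    fix x assume "x \<in> additive_closure {prod_list xs | xs. set xs \<subseteq> F \<and> length xs = N}"
    then show "x \<in> {0}" by (induction rule: additive_closure.induct) (use N in auto)
  qed
  ultimately have "f ^ N = 0" by (intro poly_mapping_eqI) auto
  \<comment> \<open>One more factor provides the positive exponent that
    \<open>nilpotent_element\<close> requires.\<close>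
  then have "f ^ Suc N = 0" by simp
  then show ?thesis unfolding nilpotent_element_def by blast
qed

section \<open>Powers of a group ring element modulo an ideal of coefficients\<close>

context ideal_congruence
begin

text \<open>\<open>P\<close> consists of monomials in \<open>C\<close>: periodicity of each
  \<open>c\<close> bounds its exponent, and commutation modulo \<open>J\<close> moves a new factor
  into place.\<close>

lemma finite_multiplicative_span:
  assumes comm: "\<And>x y. x * y \<approx> y * x" and per: "periodic_ring TYPE('a)" and "finite C"
  shows "\<exists>P. finite P \<and> 1 \<in> P \<and> (\<forall>p\<in>P. \<forall>c\<in>C. \<exists>p'\<in>P. p * c \<approx> p')"
  using \<open>finite C\<close>
proof (induction C)
  case empty
  then show ?case by (intro exI[of _ "{1}"]) simp
next
  case (insert c C)
  then obtain P where "finite P \<and> 1 \<in> P \<and> (\<forall>p\<in>P. \<forall>c\<in>C. \<exists>p'\<in>P. p * c \<approx> p')" by blast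
  then have P: "finite P" "1 \<in> P" "\<And>p c. p \<in> P \<Longrightarrow> c \<in> C \<Longrightarrow> \<exists>p'\<in>P. p * c \<approx> p'" by simp_all
  have "periodic_element c" using per by (simp add: periodic_ring_def)
  then have "\<exists>m n. m < n \<and> c ^ m = c ^ n"
    unfolding periodic_element_def by (metis linorder_neqE_nat)
  then obtain m n where mn: "m < n" "c ^ m = c ^ n" by blast
  define Q where "Q = (\<lambda>(p, e). p * c ^ e) ` (P \<times> {..<n})"
  have Q_I: "p * c ^ e \<in> Q" if "p \<in> P" "e < n" for p e using that by (auto simp: Q_def)
  have "finite Q" using P by (simp add: Q_def)
  moreover have "1 \<in> Q" using Q_I[of 1 0] P mn by simp
  moreover have "\<exists>q'\<in>Q. q * d \<approx> q'" if q: "q \<in> Q" "d \<in> insert c C" for q d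
  proof -
    obtain p e where p: "p \<in> P" "e < n" "q = p * c ^ e" using q by (auto simp: Q_def)
    show ?thesis
    proof (cases "d = c")
      case True
      have eq: "q * d = p * c ^ Suc e" by (simp only: True p power_Suc2 mult.assoc)
      show ?thesis
      proof (cases "Suc e < n")
        case True
        then show ?thesis using Q_I[OF p(1) True] eq by (metis cong_refl)
      next
        case False
        then have "Suc e = n" using p by simp
        then have "q * d = p * c ^ m" using eq mn by simp
        then show ?thesis using Q_I[OF p(1) mn(1)] by (metis cong_refl)
      qed
    next
      case False
      then obtain p' where p': "p' \<in> P" "p * d \<approx> p'" using P(3) p q by blast
      have "q * d = p * (c ^ e * d)" by (simp add: p mult.assoc)
      also have "\<dots> \<approx> p * (d * c ^ e)" by (rule cong_mult[OF cong_refl comm])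
      also have "\<dots> = (p * d) * c ^ e" by (simp add: mult.assoc)
      also have "\<dots> \<approx> p' * c ^ e" by (rule cong_mult[OF p'(2) cong_refl])
      finally show ?thesis using Q_I[OF p'(1) p(2)] by (rule rev_bexI[rotated])
    qed
  qed
  ultimately show ?case by (intro exI[of _ Q] conjI ballI)
qed

lemma finite_additive_span:
  assumes comm: "\<And>x y. x * y \<approx> y * x" and per: "periodic_ring TYPE('a)" and "finite C"
    and N: "0 < N" "of_nat N = (0::'a)"
  obtains Q where "finite Q" "0 \<in> Q" "1 \<in> Q" "\<And>x y. x \<in> Q \<Longrightarrow> y \<in> Q \<Longrightarrow> x + y \<in> Q"
    "\<And>q c. q \<in> Q \<Longrightarrow> c \<in> C \<Longrightarrow> \<exists>q'\<in>Q. q * c \<approx> q'"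
proof -
  from finite_multiplicative_span[OF comm per \<open>finite C\<close>] obtain P where
    "finite P \<and> 1 \<in> P \<and> (\<forall>p\<in>P. \<forall>c\<in>C. \<exists>p'\<in>P. p * c \<approx> p')" ..
  then have P: "finite P" "1 \<in> P" "\<And>p c. p \<in> P \<Longrightarrow> c \<in> C \<Longrightarrow> \<exists>p'\<in>P. p * c \<approx> p'" by simp_all
  show thesis
  proof (rule that[of "additive_closure P"])
    show "finite (additive_closure P)" using P(1) N by (rule finite_additive_closure)
    show "0 \<in> additive_closure P" by (rule additive_closure.zero)
    show "1 \<in> additive_closure P" using P(2) by (rule additive_closure_base)
    show "x + y \<in> additive_closure P" if "x \<in> additive_closure P" "y \<in> additive_closure P" for x y
      using that by (rule additive_closure_add)
    show "\<exists>q'\<in>additive_closure P. q * c \<approx> q'" if q: "q \<in> additive_closure P" and c: "c \<in> C" for q c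
      using q
    proof (induction rule: additive_closure.induct)
      case zero
      then show ?case by (intro bexI[of _ 0]) (auto intro: additive_closure.zero)
    next
      case (plus x y)
      obtain p' where p': "p' \<in> P" "x * c \<approx> p'" using P(3)[OF plus(1) c] by blast
      obtain q' where q': "q' \<in> additive_closure P" "y * c \<approx> q'" using plus by blast
      have "(x + y) * c \<approx> p' + q'" unfolding distrib_right by (rule cong_add[OF p'(2) q'(2)])
      then show ?case using additive_closure.plus[OF p'(1) q'(1)] by blast
    qed
  qed
qed

text \<open>All powers of \<open>f\<close> have support in the finite subgroup \<open>H\<close> and
  coefficients congruent to elements of the finite set \<open>Q\<close>, so two positive exponents
  give the same function from \<open>H\<close> to \<open>Q\<close>.\<close>

lemma group_ring_powers_cong:
  fixes f :: "'g::group_add \<Rightarrow>\<^sub>0 'a"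
  assumes comm: "\<And>x y. x * y \<approx> y * x" and per: "periodic_ring TYPE('a)"
    and N: "0 < N" "of_nat N = (0::'a)" and G: "locally_finite_group TYPE('g)"
  shows "\<exists>i j. 0 < i \<and> i < j \<and>
    (\<forall>k. Poly_Mapping.lookup (f ^ i) k \<approx> Poly_Mapping.lookup (f ^ j) k)"
proof -
  define C where "C = Poly_Mapping.lookup f ` Poly_Mapping.keys f"
  have "finite C" by (simp add: C_def)
  obtain Q where Q: "finite Q" "0 \<in> Q" "1 \<in> Q" "\<And>x y. x \<in> Q \<Longrightarrow> y \<in> Q \<Longrightarrow> x + y \<in> Q"
    "\<And>q c. q \<in> Q \<Longrightarrow> c \<in> C \<Longrightarrow> \<exists>q'\<in>Q. q * c \<approx> q'"
    using finite_additive_span[OF comm per \<open>finite C\<close> N] by blast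
  define H where "H = generated_subgroup (Poly_Mapping.keys f)"
  have H: "finite H" using G by (simp add: locally_finite_group_def H_def)
  have H_sub: "subgroup_of H" "Poly_Mapping.keys f \<subseteq> H"
    unfolding H_def by (rule subgroup_generated_subgroup, rule generated_subgroup_superset)
  have keys: "Poly_Mapping.keys (f ^ n) \<subseteq> H" for n
  proof (induction n)
    case 0
    then show ?case using H_sub by (auto simp: subgroup_of_def)
  next
    case (Suc n)
    have "Poly_Mapping.keys (f ^ Suc n) \<subseteq> {a + b | a b. a \<in> Poly_Mapping.keys f \<and> b \<in> Poly_Mapping.keys (f ^ n)}"
      using keys_mult[of f "f ^ n"] by simp
    then show ?case using H_sub Suc unfolding subgroup_of_def by blast
  qed
  have sum_Q: "\<exists>q\<in>Q. sum h I \<approx> q" if "\<And>i. i \<in> I \<Longrightarrow> \<exists>q\<in>Q. h i \<approx> q" for h :: "'g \<Rightarrow> 'a" and I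
    using that
  proof (induction I rule: infinite_finite_induct)
    case (insert i I)
    then obtain q q' where "q \<in> Q" "h i \<approx> q" "q' \<in> Q" "sum h I \<approx> q'" by (metis insertCI)
    then have "q + q' \<in> Q" "sum h (insert i I) \<approx> q + q'"
      using Q(4) insert.hyps by (simp_all add: cong_add)
    then show ?case by blast
  qed (use Q(2) in \<open>auto intro!: bexI[of _ 0]\<close>)
  have "\<exists>q\<in>Q. Poly_Mapping.lookup (f ^ n) k \<approx> q" for n k
  proof (induction n arbitrary: k)
    case 0
    show ?case using Q by (cases "k = 0") (auto simp: lookup_one)
  next
    case (Suc n)
    show ?case unfolding power_Suc2 lookup_mult_keys
    proof (intro sum_Q)
      fix a b assume b: "b \<in> Poly_Mapping.keys f"
      obtain q where q: "q \<in> Q" "Poly_Mapping.lookup (f ^ n) a \<approx> q" using Suc.IH by blast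
      obtain q' where q': "q' \<in> Q" "q * Poly_Mapping.lookup f b \<approx> q'"
        using Q(5)[OF q(1), of "Poly_Mapping.lookup f b"] b by (auto simp: C_def)
      have "Poly_Mapping.lookup (f ^ n) a * Poly_Mapping.lookup f b \<approx> q'"
        using cong_mult[OF q(2) cong_refl] q'(2) by (rule cong_trans)
      then show "\<exists>q\<in>Q. (Poly_Mapping.lookup (f ^ n) a * Poly_Mapping.lookup f b when a + b = k) \<approx> q"
        using q'(1) Q(2) by (cases "a + b = k") auto
    qed
  qed
  then obtain h where h: "\<And>n k. h n k \<in> Q" "\<And>n k. Poly_Mapping.lookup (f ^ n) k \<approx> h n k" by metis
  have "(\<lambda>n. restrict (h n) H) ` {1..} \<subseteq> H \<rightarrow>\<^sub>E Q" using h(1) by auto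
  then have "finite ((\<lambda>n. restrict (h n) H) ` {1..})"
    using H Q(1) by (meson finite_PiE finite_subset)
  then have "\<not> inj_on (\<lambda>n. restrict (h n) H) {1::nat..}"
    using finite_imageD infinite_Ici by blast
  then obtain i j where ij: "i \<ge> 1" "i < j" "restrict (h i) H = restrict (h j) H"
    by (metis (no_types, lifting) atLeast_iff linorder_inj_onI linorder_linear)
  have "Poly_Mapping.lookup (f ^ i) k \<approx> Poly_Mapping.lookup (f ^ j) k" for k
  proof (cases "k \<in> H")
    case True
    then have "h i k = h j k" using fun_cong[OF ij(3), of k] by simp
    then show ?thesis using h(2) cong_sym cong_trans by metis
  next
    case False
    then have "Poly_Mapping.lookup (f ^ n) k = 0" for n using keys[of n] by (auto simp: in_keys_iff)
    then show ?thesis by simp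
  qed
  then show ?thesis using ij by (intro exI[of _ i] exI[of _ j]) auto
qed

end

lemma periodic_ring_char:
  assumes "periodic_ring TYPE('r::ring_1)"
  obtains N where "0 < N" "of_nat N = (0::'r)"
proof -
  have "periodic_element (2::'r)" using assms by (simp add: periodic_ring_def)
  then have "\<exists>m n. m < n \<and> (2::'r) ^ m = 2 ^ n"
    unfolding periodic_element_def by (metis linorder_neqE_nat)
  then obtain m n where mn: "m < n" "(2::'r) ^ m = 2 ^ n" by blast
  have less: "(2::nat) ^ m < 2 ^ n" using mn(1) by simp
  then have "of_nat (2 ^ n - 2 ^ m) = (2::'r) ^ n - 2 ^ m" by (simp add: of_nat_diff)
  then show ?thesis using mn less by (intro that[of "2 ^ n - 2 ^ m"]) simp_all
qed

theorem periodic_group_ring: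
  assumes R: "weakly_2_primal TYPE('r::ring_1)" "periodic_ring TYPE('r)"
    and G: "locally_finite_group TYPE('g::group_add)"
  shows "periodic_ring TYPE(('r, 'g) group_ring)"
  unfolding periodic_ring_def
proof
  fix f :: "('r, 'g) group_ring"
  let ?L = "levitzki_radical :: 'r set"
  interpret ideal_congruence ?L by unfold_locales (rule levitzki_radical_greatest)
  have comm: "cong (x * y) (y * x)" for x y
    unfolding cong_def
    by (rule periodic_ring_commutator_mem[OF R(2) ideal]) (use R(1) in \<open>auto simp: weakly_2_primal_def\<close>)
  obtain N where N: "0 < N" "of_nat N = (0::'r)" using periodic_ring_char[OF R(2)] by blast
  obtain i j where ij: "0 < i" "i < j"
    "\<And>k. cong (Poly_Mapping.lookup (f ^ i) k) (Poly_Mapping.lookup (f ^ j) k)"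
    using group_ring_powers_cong[OF comm R(2) N G] by blast
  have "nilpotent_element (f ^ i - f ^ j)"
    by (rule nilpotent_group_ring_element[OF levitzki_radical_greatest(2)])
      (use ij(3) in \<open>simp add: lookup_minus cong_def\<close>)
  then show "periodic_element f"
    by (rule periodic_element_of_nilpotent_diff[OF _ _ _ _ N(1) of_nat_group_ring_eq_0[OF N(2)]])
      (use ij in auto)
qed

text \<open>The coefficient at the coset of \<open>x\<close> of the image of \<open>f\<close> in the
  group ring of the group modulo \<open>K\<close>, expressed without a quotient type.\<close>

definition coset_sum :: "'g::group_add set \<Rightarrow> 'g \<Rightarrow> ('g \<Rightarrow>\<^sub>0 'r::ring_1) \<Rightarrow> 'r" where
  "coset_sum K x f = (\<Sum>k\<in>Poly_Mapping.keys f. Poly_Mapping.lookup f k when k - x \<in> K)"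

lemma coset_sum_superset:
  assumes "finite A" "Poly_Mapping.keys f \<subseteq> A"
  shows "coset_sum K x f = (\<Sum>k\<in>A. Poly_Mapping.lookup f k when k - x \<in> K)"
  unfolding coset_sum_def using assms
  by (intro sum.mono_neutral_left) (auto simp: in_keys_iff when_def)

lemma coset_sum_zero: "coset_sum K x 0 = 0"
  by (simp add: coset_sum_def)

lemma coset_sum_add: "coset_sum K x (f + g) = coset_sum K x f + coset_sum K x g"
proof -
  let ?A = "Poly_Mapping.keys f \<union> Poly_Mapping.keys g"
  have "coset_sum K x (f + g) = (\<Sum>k\<in>?A. Poly_Mapping.lookup (f + g) k when k - x \<in> K)"
    by (rule coset_sum_superset) (simp_all add: keys_add)
  also have "\<dots> = (\<Sum>k\<in>?A. Poly_Mapping.lookup f k when k - x \<in> K)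
      + (\<Sum>k\<in>?A. Poly_Mapping.lookup g k when k - x \<in> K)"
    unfolding sum.distrib[symmetric] by (rule sum.cong) (simp_all add: lookup_add when_def)
  also have "\<dots> = coset_sum K x f + coset_sum K x g"
    by (simp add: coset_sum_superset[of ?A])
  finally show ?thesis .
qed

lemma coset_sum_uminus: "coset_sum K x (- f) = - coset_sum K x f"
  using coset_sum_add[of K x f "- f"] by (simp add: coset_sum_zero eq_neg_iff_add_eq_0 add.commute)

lemma coset_sum_diff: "coset_sum K x (f - g) = coset_sum K x f - coset_sum K x g"
  using coset_sum_add[of K x f "- g"] by (simp add: coset_sum_uminus)

lemma coset_sum_single: "coset_sum K x (Poly_Mapping.single a r) = (r when a - x \<in> K)"
  by (subst coset_sum_superset[of "{a}"]) simp_all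

context normal_subgroup
begin

text \<open>Passing from \<open>a + b - x\<close> to \<open>b - (- a + x)\<close> is conjugation by
  \<open>- a\<close>; this is where normality of \<open>K\<close> enters.\<close>

lemma coset_sum_single_mult:
  "coset_sum K x (Poly_Mapping.single a r * f) = r * coset_sum K (- a + x) f"
proof (induction f rule: poly_mapping_additive_induct)
  case zero
  then show ?case by (simp add: coset_sum_zero)
next
  case (single b s)
  have "a + b - x \<in> K \<longleftrightarrow> b - (- a + x) \<in> K"
  proof
    assume "a + b - x \<in> K"
    from normal[OF this, of "- a"] show "b - (- a + x) \<in> K"
      by (simp add: diff_add_eq_diff_diff_swap add_diff_eq add.assoc[symmetric])
  next
    assume "b - (- a + x) \<in> K"
    from normal[OF this, of a] show "a + b - x \<in> K"
      by (simp add: diff_add_eq_diff_diff_swap add_diff_eq add.assoc[symmetric])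
  qed
  then show ?case by (simp add: mult_single coset_sum_single when_def)
next
  case (add f g)
  then show ?case by (simp add: distrib_left coset_sum_add)
qed

lemma coset_sum_mult_single:
  "coset_sum K x (f * Poly_Mapping.single b s) = coset_sum K (x - b) f * s"
proof (induction f rule: poly_mapping_additive_induct)
  case zero
  then show ?case by (simp add: coset_sum_zero)
next
  case (single a r)
  have "a + b - x = a - (x - b)" by (simp add: diff_diff_eq2 add_diff_eq)
  then show ?case by (simp add: mult_single coset_sum_single when_def)
next
  case (add f g)
  then show ?case by (simp add: distrib_right coset_sum_add)
qed

text \<open>The kernel of reduction to the quotient group with coefficients modulo \<open>L\<close>;
  absorption is checked on monomials.\<close>

lemma two_sided_ideal_coset_sum:
  assumes L: "two_sided_ideal L"
  shows "two_sided_ideal {f. \<forall>x. coset_sum K x f \<in> (L :: 'r::ring_1 set)}"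
proof -
  interpret L: ideal_congruence L by unfold_locales (rule L)
  have mult: "coset_sum K x (h * f) \<in> L \<and> coset_sum K x (f * h) \<in> L"
    if f: "\<forall>x. coset_sum K x f \<in> L" for f h x
  proof (induction h rule: poly_mapping_additive_induct)
    case zero
    then show ?case by (simp add: coset_sum_zero L.zero_mem)
  next
    case (single a r)
    then show ?case
      using f by (simp add: coset_sum_single_mult coset_sum_mult_single L.left_mem L.right_mem)
  next
    case (add h h')
    then show ?case by (simp add: distrib_left distrib_right coset_sum_add L.add_mem)
  qed
  then show ?thesis
    unfolding two_sided_ideal_def
    by (auto simp: coset_sum_zero coset_sum_add coset_sum_uminus L.zero_mem L.add_mem L.minus_mem)
qed

text \<open>Modulo \<open>L\<close> and \<open>K\<close> both the coefficients and the group
  commute; biadditivity reduces the claim to monomials.\<close>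

lemma coset_sum_commutator:
  assumes L: "two_sided_ideal L" and comm: "\<And>r s. r * s - s * r \<in> (L :: 'r::ring_1 set)"
    and abelian: "\<And>a b. a + b \<approx> b + a"
  shows "coset_sum K x (f * g - g * f) \<in> L"
proof -
  interpret L: ideal_congruence L by unfold_locales (rule L)
  show ?thesis
  proof (induction f rule: poly_mapping_additive_induct)
    case zero
    then show ?case by (simp add: coset_sum_zero L.zero_mem)
  next
    case (single a r)
    show ?case
    proof (induction g rule: poly_mapping_additive_induct)
      case zero
      then show ?case by (simp add: coset_sum_zero L.zero_mem)
    next
      case (single b s)
      have "a + b - x \<in> K \<longleftrightarrow> b + a - x \<in> K"
        using abelian cong_trans cong_sym unfolding cong_def[symmetric] by blast
      then show ?case
        using comm by (simp add: coset_sum_diff mult_single coset_sum_single when_def L.zero_mem)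
    next
      case (add g h)
      have "Poly_Mapping.single a r * (g + h) - (g + h) * Poly_Mapping.single a r =
          (Poly_Mapping.single a r * g - g * Poly_Mapping.single a r) +
          (Poly_Mapping.single a r * h - h * Poly_Mapping.single a r)"
        by (simp add: distrib_left distrib_right)
      then show ?case using add by (simp only: coset_sum_add L.add_mem)
    qed
  next
    case (add f h)
    have "(f + h) * g - g * (f + h) = (f * g - g * f) + (h * g - g * h)"
      by (simp add: distrib_left distrib_right)
    then show ?case using add by (simp only: coset_sum_add L.add_mem)
  qed
qed

end

text \<open>The augmentation is the coset sum for the whole group.\<close>

lemma augmentation_mult:
  fixes f g :: "'g::group_add \<Rightarrow>\<^sub>0 'r::ring_1"
  shows "coset_sum UNIV 0 (f * g) = coset_sum UNIV 0 f * coset_sum UNIV 0 g"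
proof -
  interpret normal_subgroup "UNIV :: 'g set" by unfold_locales (simp_all add: subgroup_of_def)
  have shift: "coset_sum UNIV x h = coset_sum UNIV 0 h" for x and h :: "'g \<Rightarrow>\<^sub>0 'r"
    by (simp add: coset_sum_def)
  show ?thesis
    by (induction f rule: poly_mapping_additive_induct)
      (simp_all add: coset_sum_zero coset_sum_add distrib_right coset_sum_single_mult
        coset_sum_single shift[of "- k" for k])
qed

lemma augmentation_power:
  fixes f :: "'g::group_add \<Rightarrow>\<^sub>0 'r::ring_1"
  shows "coset_sum UNIV 0 (f ^ n) = coset_sum UNIV 0 f ^ n"
proof (induction n)
  case 0
  have "coset_sum UNIV 0 (Poly_Mapping.single (0::'g) (1::'r)) = 1"
    by (subst coset_sum_single) simp
  then show ?case by simp
next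
  case (Suc n)
  then show ?case by (simp add: augmentation_mult)
qed

section \<open>Consequences of semi-nil cleanness\<close>

lemma semi_nil_clean_ring_of_group_ring:
  assumes "semi_nil_clean_ring TYPE(('r::ring_1, 'g::group_add) group_ring)"
  shows "semi_nil_clean_ring TYPE('r)"
  unfolding semi_nil_clean_ring_def
proof
  fix x :: 'r
  let ?e = "coset_sum UNIV 0 :: ('r, 'g) group_ring \<Rightarrow> 'r"
  obtain p q :: "('r, 'g) group_ring" where pq: "periodic_element p" "nilpotent_element q"
    "Poly_Mapping.single 0 x = p + q"
    using assms unfolding semi_nil_clean_ring_def by blast
  have "x = ?e (Poly_Mapping.single 0 x)" by (simp add: coset_sum_single)
  also have "\<dots> = ?e p + ?e q" by (simp add: pq(3) coset_sum_add)
  finally have "x = ?e p + ?e q" .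
  moreover have "periodic_element (?e p)"
    using pq(1) unfolding periodic_element_def by (metis augmentation_power)
  moreover have "nilpotent_element (?e q)"
    using pq(2) unfolding nilpotent_element_def by (metis augmentation_power coset_sum_zero)
  ultimately show "\<exists>p q. periodic_element p \<and> nilpotent_element q \<and> x = p + q" by blast
qed

text \<open>Modulo \<open>J\<close> the nilpotent summand disappears, so \<open>x\<close> inherits
  the coincidence of powers of \<open>p\<close>.\<close>

lemma (in ideal_congruence) semi_nil_clean_power_diff_mem:
  assumes "semi_nil_clean_ring TYPE('a)" and nil: "\<And>x::'a. nilpotent_element x \<Longrightarrow> x \<in> J"
  shows "\<exists>i j. 0 < i \<and> 0 < j \<and> i \<noteq> j \<and> x ^ i - x ^ j \<in> J"
proof -
  obtain p q where pq: "periodic_element p" "nilpotent_element q" "x = p + q"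
    using assms(1) unfolding semi_nil_clean_ring_def by blast
  then obtain i j where ij: "0 < i" "0 < j" "i \<noteq> j" "p ^ i = p ^ j"
    by (auto simp: periodic_element_def)
  have "x \<approx> p" using pq nil by (simp add: cong_def)
  then have "x ^ i - x ^ j \<approx> p ^ i - p ^ j" by (intro cong_diff cong_power)
  then have "x ^ i - x ^ j \<in> J" by (simp add: ij(4) cong_0_iff)
  then show ?thesis using ij by blast
qed

text \<open>The element \<open>2\<close> first yields a positive characteristic; the binomial
  argument then turns nilpotency of \<open>x ^ i - x ^ j\<close> into periodicity of
  \<open>x\<close>.\<close>

theorem weakly_2_primal_semi_nil_clean_periodic:
  assumes R: "weakly_2_primal TYPE('r::ring_1)" "semi_nil_clean_ring TYPE('r)"
  shows "periodic_ring TYPE('r)"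
proof -
  let ?L = "levitzki_radical :: 'r set"
  interpret ideal_congruence ?L by unfold_locales (rule levitzki_radical_greatest)
  have nil_iff: "nilpotent_element x \<longleftrightarrow> x \<in> ?L" for x :: 'r
    using R(1) by (auto simp: weakly_2_primal_def)
  have diff: "\<exists>i j. 0 < i \<and> 0 < j \<and> i \<noteq> j \<and> nilpotent_element (x ^ i - x ^ j)" for x :: 'r
    unfolding nil_iff by (rule semi_nil_clean_power_diff_mem[OF R(2)]) (simp add: nil_iff)
  obtain i j k where ij: "i \<noteq> j" "((2::'r) ^ i - 2 ^ j) ^ k = 0"
    using diff[of 2] by (auto simp: nilpotent_element_def)
  define z where "z = ((2::int) ^ i - 2 ^ j) ^ k"
  have "z \<noteq> 0" using ij(1) by (simp add: z_def)
  have "of_int z = (0::'r)" using ij(2) by (simp add: z_def)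
  then have "of_int \<bar>z\<bar> = (0::'r)" by (simp add: abs_if)
  then have N: "0 < nat \<bar>z\<bar>" "of_nat (nat \<bar>z\<bar>) = (0::'r)"
    using \<open>z \<noteq> 0\<close> by (simp_all add: of_nat_nat)
  show ?thesis
    unfolding periodic_ring_def
  proof
    fix x :: 'r
    obtain i j where "0 < i" "0 < j" "i \<noteq> j" "nilpotent_element (x ^ i - x ^ j)"
      using diff by blast
    then show "periodic_element x" using N by (intro periodic_element_of_nilpotent_diff)
  qed
qed

text \<open>Since \<open>?f\<close> and \<open>p\<close> commute modulo \<open>J\<close> and differ
  by a nilpotent, some powers \<open>?f ^ t\<close> and \<open>p ^ t\<close> agree modulo
  \<open>J\<close>. Periodicity of \<open>p\<close> then gives two congruent powers of
  \<open>?f\<close>, which must sit in the same coset of \<open>?K\<close>.\<close>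

lemma group_ring_semi_nil_clean_torsion:
  assumes R: "weakly_2_primal TYPE('r::ring_1)" "periodic_ring TYPE('r)"
    and RG: "semi_nil_clean_ring TYPE(('r, 'g::group_add) group_ring)"
  shows "\<exists>n>0. multiple n (g::'g) \<in> lower_central_series 1"
proof -
  let ?L = "levitzki_radical :: 'r set"
  let ?K = "lower_central_series 1 :: 'g set"
  have L: "two_sided_ideal ?L" by (rule levitzki_radical_greatest)
  have nil_iff: "nilpotent_element x \<longleftrightarrow> x \<in> ?L" for x :: 'r
    using R(1) by (auto simp: weakly_2_primal_def)
  have comm: "r * s - s * r \<in> ?L" for r s :: 'r
    by (rule periodic_ring_commutator_mem[OF R(2) L]) (simp add: nil_iff)
  obtain N where N: "0 < N" "of_nat N = (0::'r)" using periodic_ring_char[OF R(2)] by blast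
  interpret K: central_section ?K "UNIV :: 'g set"
    using central_section_lower_central_series[of 0] by simp
  define J where "J = {f :: ('r, 'g) group_ring. \<forall>x. coset_sum ?K x f \<in> ?L}"
  have "two_sided_ideal J" unfolding J_def by (rule K.two_sided_ideal_coset_sum[OF L])
  then interpret J: ideal_congruence J by unfold_locales
  let ?f = "Poly_Mapping.single g 1 :: ('r, 'g) group_ring"
  obtain p q where pq: "periodic_element p" "nilpotent_element q" "?f = p + q"
    using RG unfolding semi_nil_clean_ring_def by blast
  obtain k where k: "q ^ k = 0" using pq(2) by (auto simp: nilpotent_element_def)
  have "\<exists>t>0. J.cong (?f ^ t) (p ^ t)"
  proof (rule J.powers_cong[OF _ _ N(1) of_nat_group_ring_eq_0[OF N(2)]])
    show "J.cong (?f * p) (p * ?f)"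
      unfolding J.cong_def unfolding J_def
      by (intro CollectI allI K.coset_sum_commutator[OF L comm] K.cong_commute UNIV_I)
    show "(?f - p) ^ k \<in> J" using k J.zero_mem by (simp add: pq(3))
  qed
  then obtain t where t: "t > 0" "J.cong (?f ^ t) (p ^ t)" by blast
  obtain m n where mn: "m \<noteq> n" "p ^ m = p ^ n" using pq(1) by (auto simp: periodic_element_def)
  have "J.cong ((?f ^ t) ^ m) ((p ^ t) ^ m)" "J.cong ((?f ^ t) ^ n) ((p ^ t) ^ n)"
    using J.cong_power[OF t(2)] by blast+
  moreover have "(p ^ t) ^ m = (p ^ t) ^ n" using mn(2) by (metis power_mult mult.commute)
  ultimately have "J.cong ((?f ^ t) ^ m) ((?f ^ t) ^ n)" using J.cong_trans J.cong_sym by metis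
  then have "?f ^ (t * m) - ?f ^ (t * n) \<in> J" by (simp only: J.cong_def power_mult)
  then have "coset_sum ?K x (?f ^ (t * m) - ?f ^ (t * n)) \<in> ?L" for x unfolding J_def by blast
  then have "(1 when multiple (t * m) g - x \<in> ?K) - (1 when multiple (t * n) g - x \<in> ?K) \<in> ?L" for x
    unfolding single_power coset_sum_diff coset_sum_single .
  \<comment> \<open>At this coset the first coefficient is 1; as 1 is not in \<open>?L\<close>, the
    second cannot be 0.\<close>
  from this[of "multiple (t * m) g"]
  have "1 - (1 when multiple (t * n) g - multiple (t * m) g \<in> ?K) \<in> ?L"
    using K.zero_mem by simp
  moreover have "(1::'r) \<notin> ?L" by (simp add: nilpotent_element_def flip: nil_iff)
  ultimately have mem: "multiple (t * n) g - multiple (t * m) g \<in> ?K" by (auto simp: when_def split: if_splits)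
  have sub: "multiple b g - multiple a g = multiple (b - a) g" if "a \<le> b" for a b
    using multiple_add[of "b - a" a g] that by simp
  show ?thesis
  proof (cases "m < n")
    case True
    then have "multiple (t * n - t * m) g \<in> ?K" using mem sub[of "t * m" "t * n"] by simp
    then show ?thesis using True t(1) by (intro exI[of _ "t * n - t * m"]) simp
  next
    case False
    have "multiple (t * m) g - multiple (t * n) g \<in> ?K" using K.minus_mem[OF mem] by simp
    then have "multiple (t * m - t * n) g \<in> ?K" using False sub[of "t * n" "t * m"] by simp
    then show ?thesis using False mn(1) t(1) by (intro exI[of _ "t * m - t * n"]) simp
  qed
qed

lemma periodic_ring_semi_nil_clean:
  assumes "periodic_ring TYPE('a::ring_1)" shows "semi_nil_clean_ring TYPE('a)"
  unfolding semi_nil_clean_ring_def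
proof
  fix x :: 'a
  have "periodic_element x" using assms by (simp add: periodic_ring_def)
  moreover have "nilpotent_element (0::'a)" by (auto simp: nilpotent_element_def intro: exI[of _ 1])
  ultimately show "\<exists>p q. periodic_element p \<and> nilpotent_element q \<and> x = p + q" by force
qed

theorem theorem3p2:
  assumes "weakly_2_primal TYPE('r::ring_1)"
    and "nilpotent_group TYPE('g::group_add)"
  shows "(semi_nil_clean_ring TYPE(('r, 'g) group_ring) \<longleftrightarrow>
            periodic_ring TYPE('r) \<and> locally_finite_group TYPE('g)) \<and>
         (periodic_ring TYPE('r) \<and> locally_finite_group TYPE('g) \<longleftrightarrow>
            periodic_ring TYPE(('r, 'g) group_ring))"
proof -
  have "periodic_ring TYPE('r) \<and> locally_finite_group TYPE('g)"
    if RG: "semi_nil_clean_ring TYPE(('r, 'g) group_ring)"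
  proof
    show R: "periodic_ring TYPE('r)"
      using weakly_2_primal_semi_nil_clean_periodic[OF assms(1) semi_nil_clean_ring_of_group_ring[OF RG]] .
    show "locally_finite_group TYPE('g)"
      by (rule nilpotent_group_locally_finite[OF assms(2)])
        (rule group_ring_semi_nil_clean_torsion[OF assms(1) R RG])
  qed
  \<comment> \<open>The cycle closes because a periodic group ring is semi-nil clean with nilpotent
    part 0.\<close>
  then show ?thesis
    using periodic_group_ring[OF assms(1)] periodic_ring_semi_nil_clean by blast
qed

end
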